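(* Let $G$ and $H$ be localic groups and let $f : G \to H$ be an $\infty$-Borel group homomorphism. Then $f$ is continuous, i.e., $f^*$ maps every open set of $H$ to an open set of $G$ (so $f$ comes from a continuous map of locales).
   Context: Locales $X$ are given by their frames $\mathcal{O}(X)$ of open sets; continuous maps $f : X \to Y$ correspond to frame homomorphisms $f^* : \mathcal{O}(Y) \to \mathcal{O}(X)$. A localic group is a group object in the category of locales. For a locale $X$, $\mathcal{B}_\infty(X)$ denotes the free complete Boolean algebra generated by the frame $\mathcal{O}(X)$ (universal frame homomorphism from $\mathcal{O}(X)$ into a complete Boolean algebra, which is injective; $\mathcal{B}_\infty(X)$ may be a proper class); its elements are called $\infty$-Borel sets. An $\infty$-Borel map $f : X \to Y$ is a complete Boolean homomorphism $f^* : \mathcal{B}_\infty(Y) \to \mathcal{B}_\infty(X)$ (equivalently a frame homomorphism $\mathcal{O}(Y) \to \mathcal{B}_\infty(X)$); every continuous map induces one. Locales with $\infty$-Borel maps form a category $\infty\mathrm{BorLoc}$, and the faithful forgetful functor from locales to $\infty\mathrm{BorLoc}$ preserves limits (in particular finite products), so a localic group is also a group object in $\infty\mathrm{BorLoc}$. An $\infty$-Borel group homomorphism is an $\infty$-Borel map commuting with the multiplications, inverses and identities of the two groups (as morphisms of $\infty\mathrm{BorLoc}$). *)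

theory Defs
  imports Main
begin

(* The library class complete_distrib_lattice demands complete distributivity, which is
   strictly stronger than the frame law. *)
class frame = complete_lattice +
  assumes inf_Sup_distrib: "inf a (Sup B) = Sup (inf a ` B)"

instance bool :: frame
  by standard auto

definition frame_hom :: "('a::frame \<Rightarrow> 'b::frame) \<Rightarrow> bool" where
  "frame_hom h \<longleftrightarrow>
     h top = top \<and> (\<forall>a b. h (inf a b) = inf (h a) (h b)) \<and> (\<forall>A. h (Sup A) = Sup (h ` A))"

(* The initial frame is bool (the terminal locale is the point). *)
definition init :: "bool \<Rightarrow> 'a::frame" where
  "init p = (if p then top else bot)"

lemma frame_hom_init: "frame_hom init"
proof -
  have "init (Sup A) = (Sup (init ` A) :: 'a)" for A
  proof (cases "True \<in> A")
    case True
    then have "(top :: 'a) \<le> Sup (init ` A)"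
      by (intro Sup_upper) (force simp: init_def)
    with True show ?thesis by (auto simp: init_def top_unique)
  next
    case False
    have "Sup (init ` A) \<le> (bot :: 'a)"
      using False by (intro Sup_least) (auto simp: init_def)
    with False show ?thesis by (auto simp: init_def bot_unique)
  qed
  then show ?thesis by (auto simp: frame_hom_def init_def)
qed

lemma frame_hom_init_unique: "frame_hom h \<Longrightarrow> h = init"
proof -
  assume h: "frame_hom h"
  then have "h (Sup {}) = Sup (h ` {})" unfolding frame_hom_def by blast
  then have "h False = bot" by simp
  moreover have "h True = top" using h by (simp add: frame_hom_def)
  ultimately show "h = init" by (auto simp: init_def fun_eq_iff)
qed


section \<open>Products of locales\<close>

(* O(X \<times> Y) is the coproduct of the frames O(X) and O(Y), realised as the frame of
   C-ideals: down-sets of rectangles closed under unions in each coordinate separately. *)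
definition C_ideal :: "('a::frame \<times> 'b::frame) set \<Rightarrow> bool" where
  "C_ideal D \<longleftrightarrow>
     (\<forall>a b a' b'. (a, b) \<in> D \<longrightarrow> a' \<le> a \<longrightarrow> b' \<le> b \<longrightarrow> (a', b') \<in> D) \<and>
     (\<forall>A b. (\<forall>a\<in>A. (a, b) \<in> D) \<longrightarrow> (Sup A, b) \<in> D) \<and>
     (\<forall>a B. (\<forall>b\<in>B. (a, b) \<in> D) \<longrightarrow> (a, Sup B) \<in> D)"

lemma C_idealD:
  assumes "C_ideal D"
  shows C_ideal_down: "(a, b) \<in> D \<Longrightarrow> a' \<le> a \<Longrightarrow> b' \<le> b \<Longrightarrow> (a', b') \<in> D"
    and C_ideal_Sup1: "(\<And>a. a \<in> A \<Longrightarrow> (a, b) \<in> D) \<Longrightarrow> (Sup A, b) \<in> D"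
    and C_ideal_Sup2: "(\<And>b. b \<in> B \<Longrightarrow> (a, b) \<in> D) \<Longrightarrow> (a, Sup B) \<in> D"
  using assms unfolding C_ideal_def by (elim conjE; simp)+

lemma C_ideal_Inter: "(\<And>D. D \<in> \<D> \<Longrightarrow> C_ideal D) \<Longrightarrow> C_ideal (\<Inter>\<D>)"
  unfolding C_ideal_def by (intro conjI allI impI InterI) (meson InterD)+

lemma C_ideal_Int: "C_ideal D \<Longrightarrow> C_ideal E \<Longrightarrow> C_ideal (D \<inter> E)"
  using C_ideal_Inter[of "{D, E}"] by auto

typedef (overloaded) ('a::frame, 'b::frame) tensor = "{D :: ('a \<times> 'b) set. C_ideal D}"
  morphisms rects Abs_tensor
  by (rule exI[of _ UNIV]) (simp add: C_ideal_def)

setup_lifting type_definition_tensor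

lemma C_ideal_rects: "C_ideal (rects D)"
  using rects by simp

instantiation tensor :: (frame, frame) complete_lattice
begin

lift_definition less_eq_tensor :: "('a, 'b) tensor \<Rightarrow> ('a, 'b) tensor \<Rightarrow> bool" is "(\<subseteq>)" .
lift_definition less_tensor :: "('a, 'b) tensor \<Rightarrow> ('a, 'b) tensor \<Rightarrow> bool" is "(\<subset>)" .
lift_definition inf_tensor :: "('a, 'b) tensor \<Rightarrow> ('a, 'b) tensor \<Rightarrow> ('a, 'b) tensor" is "(\<inter>)"
  by (rule C_ideal_Int)
lift_definition Inf_tensor :: "('a, 'b) tensor set \<Rightarrow> ('a, 'b) tensor" is Inter
  by (rule C_ideal_Inter)
lift_definition top_tensor :: "('a, 'b) tensor" is UNIV
  by (simp add: C_ideal_def)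
definition Sup_tensor :: "('a, 'b) tensor set \<Rightarrow> ('a, 'b) tensor" where
  "Sup_tensor \<D> = Inf {E. \<forall>D\<in>\<D>. D \<le> E}"
definition sup_tensor :: "('a, 'b) tensor \<Rightarrow> ('a, 'b) tensor \<Rightarrow> ('a, 'b) tensor" where
  "sup_tensor D E = Inf {F. D \<le> F \<and> E \<le> F}"
definition bot_tensor :: "('a, 'b) tensor" where
  "bot_tensor = Inf UNIV"

instance
proof -
  have low: "Inf A \<le> x" if "x \<in> A" for x :: "('a, 'b) tensor" and A
    using that by (auto simp: less_eq_tensor.rep_eq Inf_tensor.rep_eq)
  have great: "z \<le> Inf A" if "\<And>x. x \<in> A \<Longrightarrow> z \<le> x" for z :: "('a, 'b) tensor" and A
    using that by (auto simp: less_eq_tensor.rep_eq Inf_tensor.rep_eq)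
  show "OFCLASS(('a, 'b) tensor, complete_lattice_class)"
  proof
    fix x y z :: "('a, 'b) tensor" and A
    show "(x < y) = (x \<le> y \<and> \<not> y \<le> x)" by transfer auto
    show "x \<le> x" by transfer auto
    show "x \<le> y \<Longrightarrow> y \<le> z \<Longrightarrow> x \<le> z" by transfer auto
    show "x \<le> y \<Longrightarrow> y \<le> x \<Longrightarrow> x = y" by transfer auto
    show "inf x y \<le> x" by transfer auto
    show "inf x y \<le> y" by transfer auto
    show "x \<le> y \<Longrightarrow> x \<le> z \<Longrightarrow> x \<le> inf y z" by transfer auto
    show "x \<le> sup x y" unfolding sup_tensor_def by (rule great) auto
    show "y \<le> sup x y" unfolding sup_tensor_def by (rule great) auto
    show "y \<le> x \<Longrightarrow> z \<le> x \<Longrightarrow> sup y z \<le> x" unfolding sup_tensor_def by (rule low) auto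
    show "x \<in> A \<Longrightarrow> Inf A \<le> x" by (rule low)
    show "(\<And>x. x \<in> A \<Longrightarrow> z \<le> x) \<Longrightarrow> z \<le> Inf A" by (rule great)
    show "x \<in> A \<Longrightarrow> x \<le> Sup A" unfolding Sup_tensor_def by (rule great) auto
    show "(\<And>x. x \<in> A \<Longrightarrow> x \<le> z) \<Longrightarrow> Sup A \<le> z" unfolding Sup_tensor_def by (rule low) auto
    show "Inf {} = (top :: ('a, 'b) tensor)" by transfer auto
    show "Sup {} = (bot :: ('a, 'b) tensor)" by (simp add: Sup_tensor_def bot_tensor_def)
  qed
qed

end

instance tensor :: (frame, frame) frame
proof
  fix D :: "('a, 'b) tensor" and \<E>
  let ?S = "Sup (inf D ` \<E>)"
  define F where "F = {(a, b). \<forall>c d. (c, d) \<in> rects D \<longrightarrow> (inf c a, inf d b) \<in> rects ?S}"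
  have S: "C_ideal (rects ?S)" by (rule C_ideal_rects)
  have "C_ideal F"
    unfolding C_ideal_def
  proof (intro conjI allI impI)
    fix a b a' b' assume "(a, b) \<in> F" "a' \<le> a" "b' \<le> b"
    have "(inf c a', inf d b') \<in> rects ?S" if "(c, d) \<in> rects D" for c d
    proof -
      have "(inf c a, inf d b) \<in> rects ?S" using \<open>(a, b) \<in> F\<close> that unfolding F_def by blast
      moreover have "inf c a' \<le> inf c a" "inf d b' \<le> inf d b"
        using \<open>a' \<le> a\<close> \<open>b' \<le> b\<close> by (auto intro: le_infI2)
      ultimately show ?thesis by (rule C_ideal_down[OF S])
    qed
    then show "(a', b') \<in> F" unfolding F_def by blast
  next
    fix A b assume A: "\<forall>a\<in>A. (a, b) \<in> F"
    have "(inf c (Sup A), inf d b) \<in> rects ?S" if "(c, d) \<in> rects D" for c d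
    proof -
      have "(x, inf d b) \<in> rects ?S" if "x \<in> inf c ` A" for x
        using A \<open>(c, d) \<in> rects D\<close> that unfolding F_def by auto
      then show ?thesis unfolding inf_Sup_distrib by (rule C_ideal_Sup1[OF S])
    qed
    then show "(Sup A, b) \<in> F" unfolding F_def by blast
  next
    fix a B assume B: "\<forall>b\<in>B. (a, b) \<in> F"
    have "(inf c a, inf d (Sup B)) \<in> rects ?S" if "(c, d) \<in> rects D" for c d
    proof -
      have "(inf c a, y) \<in> rects ?S" if "y \<in> inf d ` B" for y
        using B \<open>(c, d) \<in> rects D\<close> that unfolding F_def by auto
      then show ?thesis unfolding inf_Sup_distrib by (rule C_ideal_Sup2[OF S])
    qed
    then show "(a, Sup B) \<in> F" unfolding F_def by blast
  qed
  then have F: "rects (Abs_tensor F) = F" by (simp add: Abs_tensor_inverse)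
  have "E \<le> Abs_tensor F" if "E \<in> \<E>" for E
  proof -
    have le: "inf D E \<le> ?S" using that by (intro Sup_upper) auto
    have "(a, b) \<in> F" if "(a, b) \<in> rects E" for a b
    proof -
      have "(inf c a, inf d b) \<in> rects (inf D E)" if "(c, d) \<in> rects D" for c d
        using C_ideal_down[OF C_ideal_rects that] C_ideal_down[OF C_ideal_rects \<open>(a, b) \<in> rects E\<close>]
        by (simp add: inf_tensor.rep_eq)
      then show ?thesis using le unfolding F_def less_eq_tensor.rep_eq by blast
    qed
    then show ?thesis by (auto simp: less_eq_tensor.rep_eq F)
  qed
  then have "Sup \<E> \<le> Abs_tensor F" by (rule Sup_least)
  then have le: "rects (Sup \<E>) \<subseteq> F" by (simp add: less_eq_tensor.rep_eq F)
  have "(a, b) \<in> rects ?S" if "(a, b) \<in> rects D" "(a, b) \<in> rects (Sup \<E>)" for a b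
  proof -
    have "(inf a a, inf b b) \<in> rects ?S" using that le unfolding F_def by blast
    then show ?thesis by simp
  qed
  then have "inf D (Sup \<E>) \<le> ?S" by (auto simp: less_eq_tensor.rep_eq inf_tensor.rep_eq)
  moreover have "?S \<le> inf D (Sup \<E>)"
    by (intro Sup_least) (auto intro: le_infI2 Sup_upper)
  ultimately show "inf D (Sup \<E>) = ?S" by (rule antisym)
qed

(* The open rectangle a \<times> b; the last two disjuncts are the empty rectangles,
   which belong to every C-ideal. *)
lift_definition rect :: "'a::frame \<Rightarrow> 'b::frame \<Rightarrow> ('a, 'b) tensor" is
  "\<lambda>a b. {(x, y). (x \<le> a \<and> y \<le> b) \<or> x = bot \<or> y = bot}"
  unfolding C_ideal_def
  by (auto simp: Sup_le_iff bot_unique intro: order_trans)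

(* Inverse images along the two projections. *)
definition proj1 :: "'a::frame \<Rightarrow> ('a, 'b::frame) tensor" where
  "proj1 a = rect a top"

definition proj2 :: "'b::frame \<Rightarrow> ('a::frame, 'b) tensor" where
  "proj2 b = rect top b"

(* Inverse image along the map Z \<rightarrow> X \<times> Y whose components have inverse images g and h. *)
definition pairing ::
    "('a::frame \<Rightarrow> 'c::frame) \<Rightarrow> ('b::frame \<Rightarrow> 'c) \<Rightarrow> ('a, 'b) tensor \<Rightarrow> 'c" where
  "pairing g h D = (SUP (a, b)\<in>rects D. inf (g a) (h b))"

lemma C_ideal_below:
  fixes g :: "'a::frame \<Rightarrow> 'c::semilattice_inf" and h :: "'b::frame \<Rightarrow> 'c"
  assumes "mono g" "mono h"
    and "\<And>A y. (\<And>a. a \<in> A \<Longrightarrow> inf (g a) y \<le> t) \<Longrightarrow> inf (g (Sup A)) y \<le> t"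
    and "\<And>B y. (\<And>b. b \<in> B \<Longrightarrow> inf (h b) y \<le> t) \<Longrightarrow> inf (h (Sup B)) y \<le> t"
  shows "C_ideal {(a, b). inf (g a) (h b) \<le> t}"
  unfolding C_ideal_def
proof (intro conjI allI impI)
  fix a b a' b'
  assume "(a, b) \<in> {(a, b). inf (g a) (h b) \<le> t}" "a' \<le> a" "b' \<le> b"
  then show "(a', b') \<in> {(a, b). inf (g a) (h b) \<le> t}"
    using inf_mono[OF monoD[OF assms(1) \<open>a' \<le> a\<close>] monoD[OF assms(2) \<open>b' \<le> b\<close>]]
    by (metis (mono_tags, lifting) case_prodD case_prodI mem_Collect_eq order_trans)
next
  fix A b assume "\<forall>a\<in>A. (a, b) \<in> {(a, b). inf (g a) (h b) \<le> t}"
  then show "(Sup A, b) \<in> {(a, b). inf (g a) (h b) \<le> t}" using assms(3)[of A "h b"] by auto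
next
  fix a B assume "\<forall>b\<in>B. (a, b) \<in> {(a, b). inf (g a) (h b) \<le> t}"
  then show "(a, Sup B) \<in> {(a, b). inf (g a) (h b) \<le> t}"
    using assms(4)[of B "g a"] by (auto simp: inf.commute)
qed

lemma rects_Sup_below:
  assumes "C_ideal F" "\<And>D. D \<in> \<D> \<Longrightarrow> rects D \<subseteq> F"
  shows "rects (Sup \<D>) \<subseteq> F"
proof -
  have "Sup \<D> \<le> Abs_tensor F"
    using assms by (intro Sup_least) (simp add: less_eq_tensor.rep_eq Abs_tensor_inverse)
  then show ?thesis using assms by (simp add: less_eq_tensor.rep_eq Abs_tensor_inverse)
qed

lemma C_ideal_bot:
  assumes "C_ideal F" shows "(bot, b) \<in> F" "(a, bot) \<in> F"
proof -
  have "(Sup {}, b) \<in> F" "(a, Sup {}) \<in> F"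
    by (rule C_ideal_Sup1[OF assms] C_ideal_Sup2[OF assms], simp)+
  then show "(bot, b) \<in> F" "(a, bot) \<in> F" by simp_all
qed

lemma rects_rect: "rects (rect a b) = {(x, y). (x \<le> a \<and> y \<le> b) \<or> x = bot \<or> y = bot}"
  by (rule rect.rep_eq)

lemma rect_le_iff: "rect a b \<le> D \<longleftrightarrow> (a, b) \<in> rects D"
proof
  show "(a, b) \<in> rects D" if "rect a b \<le> D"
    using that by (auto simp: less_eq_tensor.rep_eq rects_rect)
  show "rect a b \<le> D" if "(a, b) \<in> rects D"
    using C_ideal_down[OF C_ideal_rects that] C_ideal_bot[OF C_ideal_rects[of D]]
    by (auto simp: less_eq_tensor.rep_eq rects_rect)
qed

lemma tensor_eq_Sup_rect: "D = (SUP (a, b)\<in>rects D. rect a b)"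
proof (rule antisym)
  have "(a, b) \<in> rects (SUP (a, b)\<in>rects D. rect a b)" if "(a, b) \<in> rects D" for a b
    unfolding rect_le_iff[symmetric] using that by (auto intro: SUP_upper2)
  then show "D \<le> (SUP (a, b)\<in>rects D. rect a b)" by (auto simp: less_eq_tensor.rep_eq)
  show "(SUP (a, b)\<in>rects D. rect a b) \<le> D" by (auto intro!: SUP_least simp: rect_le_iff)
qed

lemma rect_eq_inf: "rect a b = inf (proj1 a) (proj2 b)"
  unfolding proj1_def proj2_def
  by (rule rects_inject[THEN iffD1]) (auto simp: inf_tensor.rep_eq rects_rect bot_unique)

lemma rect_top: "rect top top = top"
  by (rule rects_inject[THEN iffD1]) (auto simp: rects_rect top_tensor.rep_eq)

lemma frame_hom_mono: "frame_hom h \<Longrightarrow> mono h"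
  unfolding frame_hom_def by (metis inf.absorb_iff1 inf.cobounded2 monoI)

lemma frame_hom_proj1: "frame_hom (proj1 :: 'a::frame \<Rightarrow> ('a, 'b::frame) tensor)"
  unfolding frame_hom_def
proof (intro conjI allI)
  show "proj1 top = (top :: ('a, 'b) tensor)"
    by (rule rects_inject[THEN iffD1]) (auto simp: proj1_def rects_rect top_tensor.rep_eq)
  show "proj1 (inf a b) = (inf (proj1 a) (proj1 b) :: ('a, 'b) tensor)" for a b
    by (rule rects_inject[THEN iffD1])
       (auto simp: proj1_def rects_rect inf_tensor.rep_eq)
  show "proj1 (Sup A) = (Sup (proj1 ` A) :: ('a, 'b) tensor)" for A
  proof (rule antisym)
    have "(a, top) \<in> rects (Sup (proj1 ` A) :: ('a, 'b) tensor)" if "a \<in> A" for a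
      unfolding rect_le_iff[symmetric] using that by (auto intro: Sup_upper simp: proj1_def)
    then show "proj1 (Sup A) \<le> (Sup (proj1 ` A) :: ('a, 'b) tensor)"
      unfolding proj1_def[of "Sup A"] rect_le_iff by (rule C_ideal_Sup1[OF C_ideal_rects])
    show "(Sup (proj1 ` A) :: ('a, 'b) tensor) \<le> proj1 (Sup A)"
      by (auto intro!: Sup_least simp: proj1_def rect_le_iff rects_rect Sup_upper)
  qed
qed

lemma frame_hom_proj2: "frame_hom (proj2 :: 'b::frame \<Rightarrow> ('a::frame, 'b) tensor)"
  unfolding frame_hom_def
proof (intro conjI allI)
  show "proj2 top = (top :: ('a, 'b) tensor)"
    by (rule rects_inject[THEN iffD1]) (auto simp: proj2_def rects_rect top_tensor.rep_eq)
  show "proj2 (inf a b) = (inf (proj2 a) (proj2 b) :: ('a, 'b) tensor)" for a b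
    by (rule rects_inject[THEN iffD1])
       (auto simp: proj2_def rects_rect inf_tensor.rep_eq)
  show "proj2 (Sup A) = (Sup (proj2 ` A) :: ('a, 'b) tensor)" for A
  proof (rule antisym)
    have "(top, a) \<in> rects (Sup (proj2 ` A) :: ('a, 'b) tensor)" if "a \<in> A" for a
      unfolding rect_le_iff[symmetric] using that by (auto intro: Sup_upper simp: proj2_def)
    then show "proj2 (Sup A) \<le> (Sup (proj2 ` A) :: ('a, 'b) tensor)"
      unfolding proj2_def[of "Sup A"] rect_le_iff by (rule C_ideal_Sup2[OF C_ideal_rects])
    show "(Sup (proj2 ` A) :: ('a, 'b) tensor) \<le> proj2 (Sup A)"
      by (auto intro!: Sup_least simp: proj2_def rect_le_iff rects_rect Sup_upper)
  qed
qed

lemma frame_hom_Sup_below: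
  assumes "frame_hom g" "\<And>a. a \<in> A \<Longrightarrow> inf (g a) y \<le> t"
  shows "inf (g (Sup A)) y \<le> t"
proof -
  have "inf y (g (Sup A)) = Sup (inf y ` g ` A)"
    using assms(1) by (simp add: frame_hom_def inf_Sup_distrib)
  also have "\<dots> \<le> t" using assms(2) by (intro Sup_least) (auto simp: inf.commute)
  finally show ?thesis by (simp add: inf.commute)
qed

lemma pairing_le_iff: "pairing g h D \<le> t \<longleftrightarrow> (\<forall>(a, b)\<in>rects D. inf (g a) (h b) \<le> t)"
  unfolding pairing_def SUP_le_iff by (auto simp: case_prod_beta)

theorem tensor_coproduct:
  fixes g :: "'a::frame \<Rightarrow> 'c::frame" and h :: "'b::frame \<Rightarrow> 'c"
  assumes g: "frame_hom g" and h: "frame_hom h"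
  shows "frame_hom (pairing g h)" "pairing g h \<circ> proj1 = g" "pairing g h \<circ> proj2 = h"
    and "frame_hom p \<Longrightarrow> p \<circ> proj1 = g \<Longrightarrow> p \<circ> proj2 = h \<Longrightarrow> p = pairing g h"
proof -
  have bots: "g bot = bot" "h bot = bot"
    using g h unfolding frame_hom_def by (metis Sup_empty image_empty)+
  have tops: "g top = top" "h top = top" using g h by (simp_all add: frame_hom_def)
  have rect: "pairing g h (rect a b) = inf (g a) (h b)" for a b
  proof (rule antisym)
    show "pairing g h (rect a b) \<le> inf (g a) (h b)"
      unfolding pairing_le_iff
      by (auto simp: rects_rect bots intro: le_infI1 le_infI2 monoD[OF frame_hom_mono[OF g]]
          monoD[OF frame_hom_mono[OF h]])
    have "(a, b) \<in> rects (rect a b)" by (simp add: rects_rect)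
    then show "inf (g a) (h b) \<le> pairing g h (rect a b)"
      unfolding pairing_def by (auto intro: SUP_upper2)
  qed
  show "pairing g h \<circ> proj1 = g" "pairing g h \<circ> proj2 = h"
    by (simp_all add: fun_eq_iff proj1_def proj2_def rect tops)
  have ub: "inf (g a) (h b) \<le> pairing g h D" if "(a, b) \<in> rects D" for a b D
    unfolding pairing_def using that by (auto intro: SUP_upper2)
  have mono: "pairing g h D \<le> pairing g h E" if "D \<le> E" for D E
    unfolding pairing_le_iff using that by (auto simp: less_eq_tensor.rep_eq intro: ub)
  show "frame_hom (pairing g h)"
    unfolding frame_hom_def
  proof (intro conjI allI)
    show "pairing g h top = top" using rect[of top top] tops by (simp add: rect_top)
    show "pairing g h (inf D E) = inf (pairing g h D) (pairing g h E)" for D E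
    proof (rule antisym)
      show "pairing g h (inf D E) \<le> inf (pairing g h D) (pairing g h E)"
        by (simp add: mono)
      have 1: "inf (inf (g a) (h b)) (inf (g c) (h d)) \<le> pairing g h (inf D E)"
        if "(a, b) \<in> rects D" "(c, d) \<in> rects E" for a b c d
      proof -
        have "(inf a c, inf b d) \<in> rects (inf D E)"
          using C_ideal_down[OF C_ideal_rects that(1)] C_ideal_down[OF C_ideal_rects that(2)]
          by (simp add: inf_tensor.rep_eq)
        from ub[OF this] show ?thesis using g h by (simp add: frame_hom_def inf_aci)
      qed
      have 2: "inf (inf (g a) (h b)) (pairing g h E) \<le> pairing g h (inf D E)"
        if "(a, b) \<in> rects D" for a b
        unfolding pairing_def[of g h E] inf_Sup_distrib using 1[OF that] by (auto intro!: SUP_least)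
      have "inf (pairing g h E) (pairing g h D) \<le> pairing g h (inf D E)"
        unfolding pairing_def[of g h D] inf_Sup_distrib
        using 2 by (auto intro!: SUP_least simp: inf.commute)
      then show "inf (pairing g h D) (pairing g h E) \<le> pairing g h (inf D E)"
        by (simp add: inf.commute)
    qed
    show "pairing g h (Sup \<D>) = Sup (pairing g h ` \<D>)" for \<D>
    proof (rule antisym)
      have "rects (Sup \<D>) \<subseteq> {(a, b). inf (g a) (h b) \<le> Sup (pairing g h ` \<D>)}"
        by (intro rects_Sup_below C_ideal_below frame_hom_mono g h frame_hom_Sup_below[OF g]
            frame_hom_Sup_below[OF h]) (auto intro: order_trans[OF ub] Sup_upper)
      then show "pairing g h (Sup \<D>) \<le> Sup (pairing g h ` \<D>)"
        unfolding pairing_le_iff by auto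
      show "Sup (pairing g h ` \<D>) \<le> pairing g h (Sup \<D>)"
        by (auto intro!: Sup_least mono Sup_upper)
    qed
  qed
  show "p = pairing g h" if p: "frame_hom p" "p \<circ> proj1 = g" "p \<circ> proj2 = h"
  proof
    fix D
    have pr: "p (rect a b) = inf (g a) (h b)" for a b
      using p by (auto simp: rect_eq_inf frame_hom_def)
    have "p D = p (SUP (a, b)\<in>rects D. rect a b)" using tensor_eq_Sup_rect[of D] by simp
    also have "\<dots> = (SUP x\<in>rects D. p (case x of (a, b) \<Rightarrow> rect a b))"
      using p(1) by (simp add: frame_hom_def image_image)
    also have "\<dots> = pairing g h D"
      unfolding pairing_def by (intro SUP_cong refl) (auto simp: pr)
    finally show "p D = pairing g h D" .
  qed
qed


section \<open>Localic groups\<close>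

(* A group object in the category of locales, its structure maps given by inverse images:
   m, e, i are the inverse images along multiplication, identity and inversion.
   If u, v are the inverse images along maps x, y into the group, then
   pairing u v \<circ> m is the inverse image along the product map xy. *)
locale localic_group =
  fixes m :: "'g::frame \<Rightarrow> ('g, 'g) tensor" and e :: "'g \<Rightarrow> bool" and i :: "'g \<Rightarrow> 'g"
  assumes mult_hom: "frame_hom m"
    and unit_hom: "frame_hom e"
    and inv_hom: "frame_hom i"
    and assoc:
      "pairing (pairing proj1 (proj2 \<circ> proj1) \<circ> m) (proj2 \<circ> proj2) \<circ> m =
       (pairing proj1 (pairing (proj2 \<circ> proj1) (proj2 \<circ> proj2) \<circ> m) \<circ> m
         :: 'g \<Rightarrow> ('g, ('g, 'g) tensor) tensor)"
    and left_unit: "pairing (init \<circ> e) id \<circ> m = id"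
    and right_unit: "pairing id (init \<circ> e) \<circ> m = id"
    and left_inv: "pairing i id \<circ> m = init \<circ> e"
    and right_inv: "pairing id i \<circ> m = init \<circ> e"


section \<open>Infinitary Borel sets\<close>

(* Terms for Borel sets, with joins indexed by the type 'k. *)
datatype (dead 'a, dead 'k) bterm =
    Gen 'a
  | Neg "('a, 'k) bterm"
  | Conj "('a, 'k) bterm" "('a, 'k) bterm"
  | Join "'k \<Rightarrow> ('a, 'k) bterm"

(* The least preorder whose quotient is a Boolean algebra with all joins indexed by 'k, such that
   Gen preserves finite meets and arbitrary joins. *)
inductive entails :: "('a::frame, 'k) bterm \<Rightarrow> ('a, 'k) bterm \<Rightarrow> bool" where
  ent_refl: "entails s s"
| ent_trans: "entails s t \<Longrightarrow> entails t u \<Longrightarrow> entails s u"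
| ent_conj1: "entails (Conj s t) s"
| ent_conj2: "entails (Conj s t) t"
| ent_conjI: "entails u s \<Longrightarrow> entails u t \<Longrightarrow> entails u (Conj s t)"
| ent_contr: "entails (Conj s (Neg s)) (Gen bot)"
| ent_negI: "entails (Conj u s) (Gen bot) \<Longrightarrow> entails u (Neg s)"
| ent_dneg: "entails (Neg (Neg s)) s"
| ent_join_upper: "entails (s k) (Join s)"
| ent_join_least: "(\<And>k. entails (s k) t) \<Longrightarrow> entails (Join s) t"
| ent_gen_mono: "a \<le> b \<Longrightarrow> entails (Gen a) (Gen b)"
| ent_gen_top: "entails s (Gen top)"
| ent_gen_inf: "entails (Conj (Gen a) (Gen b)) (Gen (inf a b))"
| ent_gen_Sup: "(\<And>a. a \<in> A \<Longrightarrow> entails (Gen a) t) \<Longrightarrow> entails (Gen (Sup A)) t"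

(* The free complete Boolean algebra on a frame 'a is in general a proper class. It is the
   directed union over all cardinals of its subalgebras generated by 'a under joins of that size;
   this type is the stage given by the cardinality of 'k. No stage collapses in a larger one:
   gen preserves all joins, hence so does its composite into the MacNeille completion. *)
quotient_type (overloaded) ('a, 'k) borel =
  "('a::frame, 'k) bterm" / "\<lambda>s t. entails s t \<and> entails t s"
  by (rule equivpI) (auto intro!: reflpI sympI transpI intro: ent_refl ent_trans)

lift_definition gen :: "'a::frame \<Rightarrow> ('a, 'k) borel" is Gen .

lift_definition join :: "('k \<Rightarrow> ('a::frame, 'k) borel) \<Rightarrow> ('a, 'k) borel" is Join
  by (auto simp: rel_fun_def intro!: ent_join_least intro: ent_trans ent_join_upper)

instantiation borel :: (frame, type) boolean_algebra
begin

lift_definition less_eq_borel :: "('a, 'b) borel \<Rightarrow> ('a, 'b) borel \<Rightarrow> bool" is entails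
  by (meson ent_trans)
lift_definition inf_borel :: "('a, 'b) borel \<Rightarrow> ('a, 'b) borel \<Rightarrow> ('a, 'b) borel" is Conj
  by (meson ent_trans ent_conj1 ent_conj2 ent_conjI)
lift_definition uminus_borel :: "('a, 'b) borel \<Rightarrow> ('a, 'b) borel" is Neg
  by (meson ent_trans ent_conj1 ent_conj2 ent_conjI ent_contr ent_negI)
definition less_borel :: "('a, 'b) borel \<Rightarrow> ('a, 'b) borel \<Rightarrow> bool" where
  "less_borel x y \<longleftrightarrow> x \<le> y \<and> \<not> y \<le> x"
definition sup_borel :: "('a, 'b) borel \<Rightarrow> ('a, 'b) borel \<Rightarrow> ('a, 'b) borel" where
  "sup_borel x y = - inf (- x) (- y)"
definition minus_borel :: "('a, 'b) borel \<Rightarrow> ('a, 'b) borel \<Rightarrow> ('a, 'b) borel" where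
  "minus_borel x y = inf x (- y)"
definition top_borel :: "('a, 'b) borel" where
  "top_borel = gen top"
definition bot_borel :: "('a, 'b) borel" where
  "bot_borel = gen bot"

instance
proof -
  let ?b = "bot :: ('a, 'b) borel"
  have refl: "x \<le> x" for x :: "('a, 'b) borel"
    by transfer (rule ent_refl)
  have trans: "x \<le> y \<Longrightarrow> y \<le> z \<Longrightarrow> x \<le> z" for x y z :: "('a, 'b) borel"
    by transfer (rule ent_trans)
  have anti: "x \<le> y \<Longrightarrow> y \<le> x \<Longrightarrow> x = y" for x y :: "('a, 'b) borel"
    by transfer blast
  have inf1: "inf x y \<le> x" and inf2: "inf x y \<le> y" for x y :: "('a, 'b) borel"
    by (transfer, rule ent_conj1, transfer, rule ent_conj2)
  have infI: "z \<le> x \<Longrightarrow> z \<le> y \<Longrightarrow> z \<le> inf x y" for x y z :: "('a, 'b) borel"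
    by transfer (rule ent_conjI)
  have contr: "inf x (- x) \<le> ?b" for x
    unfolding bot_borel_def by transfer (rule ent_contr)
  have negI: "inf z x \<le> ?b \<Longrightarrow> z \<le> - x" for x z
    unfolding bot_borel_def by transfer (rule ent_negI)
  have dneg: "- (- x) \<le> x" for x :: "('a, 'b) borel"
    by transfer (rule ent_dneg)
  have top: "x \<le> top" for x :: "('a, 'b) borel"
    unfolding top_borel_def by transfer (rule ent_gen_top)
  have bot: "?b \<le> x" for x
    unfolding bot_borel_def
  proof transfer
    fix t :: "('a, 'b) bterm"
    show "entails (Gen bot) t" using ent_gen_Sup[of "{}" t] by simp
  qed
  have contr': "z \<le> x \<Longrightarrow> z \<le> - x \<Longrightarrow> z \<le> y" for x y z :: "('a, 'b) borel"
    by (meson infI contr bot trans)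
  have neg_mono: "x \<le> y \<Longrightarrow> - y \<le> - x" for x y :: "('a, 'b) borel"
    by (meson inf1 inf2 trans contr' negI)
  have byc: "inf z (- x) \<le> ?b \<Longrightarrow> z \<le> x" for x z
    by (meson dneg negI trans)
  have sup1: "x \<le> sup x y" and sup2: "y \<le> sup x y" for x y :: "('a, 'b) borel"
    unfolding sup_borel_def by (meson inf1 inf2 trans contr' negI)+
  have supl: "sup x y \<le> z" if "x \<le> z" "y \<le> z" for x y z :: "('a, 'b) borel"
    unfolding sup_borel_def by (meson that neg_mono infI dneg trans)
  have res: "inf (sup x y) (- x) \<le> y" for x y :: "('a, 'b) borel"
  proof (rule byc)
    let ?w = "inf (inf (sup x y) (- x)) (- y)"
    have "?w \<le> inf (- x) (- y)" "?w \<le> - inf (- x) (- y)"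
      unfolding sup_borel_def by (meson inf1 inf2 infI trans)+
    then show "?w \<le> ?b" by (rule contr')
  qed
  have distrib: "inf (sup x y) (sup x z) \<le> sup x (inf y z)" for x y z :: "('a, 'b) borel"
  proof (rule byc)
    let ?u = "sup x (inf y z)"
    let ?w = "inf (inf (sup x y) (sup x z)) (- ?u)"
    have "?w \<le> - ?u" by (rule inf2)
    moreover have "- ?u \<le> - x" by (rule neg_mono[OF sup1])
    ultimately have "?w \<le> - x" by (rule trans)
    then have "?w \<le> inf (sup x y) (- x)" "?w \<le> inf (sup x z) (- x)"
      by (meson inf1 inf2 infI trans)+
    then have "?w \<le> inf y z" by (meson res infI trans)
    then have "?w \<le> ?u" by (meson sup2 trans)
    then show "?w \<le> ?b" using \<open>?w \<le> - ?u\<close> by (rule contr')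
  qed
  show "OFCLASS(('a, 'b) borel, boolean_algebra_class)"
  proof
    fix x y z :: "('a, 'b) borel"
    show "x < y \<longleftrightarrow> x \<le> y \<and> \<not> y \<le> x" by (rule less_borel_def)
    show "x \<le> x" by (rule refl)
    show "x \<le> y \<Longrightarrow> y \<le> z \<Longrightarrow> x \<le> z" by (rule trans)
    show "x \<le> y \<Longrightarrow> y \<le> x \<Longrightarrow> x = y" by (rule anti)
    show "inf x y \<le> x" "inf x y \<le> y" by (rule inf1 inf2)+
    show "x \<le> y \<Longrightarrow> x \<le> z \<Longrightarrow> x \<le> inf y z" by (rule infI)
    show "x \<le> sup x y" "y \<le> sup x y" by (rule sup1 sup2)+
    show "y \<le> x \<Longrightarrow> z \<le> x \<Longrightarrow> sup y z \<le> x" by (rule supl)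
    show "bot \<le> x" "x \<le> top" by (rule bot top)+
    show "sup x (inf y z) = inf (sup x y) (sup x z)"
      by (rule anti[OF supl[OF infI[OF sup1 sup1] infI] distrib]) (meson inf1 inf2 sup2 trans)+
    show "inf x (- x) = bot" by (rule anti[OF contr bot])
    show "sup x (- x) = top"
      by (rule anti[OF top]) (unfold sup_borel_def, rule negI, meson inf1 inf2 trans contr')
    show "x - y = inf x (- y)" by (rule minus_borel_def)
  qed
qed

end

lemma join_abs: "join (\<lambda>k. abs_borel (s k)) = abs_borel (Join s)"
  using join.abs_eq[of s] by (simp add: comp_def)

lemma join_upper: "s k \<le> join s"
  by transfer (rule ent_join_upper)

lemma join_least: "(\<And>k. s k \<le> t) \<Longrightarrow> join s \<le> t"
  by transfer (rule ent_join_least)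

lemma gen_top: "gen top = top"
  by (simp add: top_borel_def)

lemma gen_bot: "gen bot = bot"
  by (simp add: bot_borel_def)

lemma gen_mono: "a \<le> b \<Longrightarrow> gen a \<le> gen b"
  by transfer (rule ent_gen_mono)

lemma gen_inf: "gen (inf a b) = inf (gen a) (gen b)"
proof (rule antisym)
  show "gen (inf a b) \<le> inf (gen a) (gen b)" by (simp add: gen_mono)
  show "inf (gen a) (gen b) \<le> gen (inf a b)" by transfer (rule ent_gen_inf)
qed

lemma gen_Sup_least: "(\<And>a. a \<in> A \<Longrightarrow> gen a \<le> t) \<Longrightarrow> gen (Sup A) \<le> t"
  by transfer (rule ent_gen_Sup)

lemma borel_induct [case_names gen neg conj join]:
  assumes "\<And>a. P (gen a)" "\<And>x. P x \<Longrightarrow> P (- x)"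
    "\<And>x y. P x \<Longrightarrow> P y \<Longrightarrow> P (inf x y)" "\<And>s. (\<And>k. P (s k)) \<Longrightarrow> P (join s)"
  shows "P x"
proof (induct x rule: borel.abs_induct)
  case (1 t)
  show ?case
  proof (induct t)
    case (Join s)
    then show ?case using assms(4)[of "\<lambda>k. abs_borel (s k)"] by (simp add: join_abs)
  qed (use assms in \<open>simp_all add: gen.abs_eq[symmetric] uminus_borel.abs_eq[symmetric]
        inf_borel.abs_eq[symmetric]\<close>)
qed

primrec eval_bterm ::
    "('a \<Rightarrow> 'c::boolean_algebra) \<Rightarrow> (('k \<Rightarrow> 'c) \<Rightarrow> 'c) \<Rightarrow> ('a, 'k) bterm \<Rightarrow> 'c" where
  "eval_bterm g J (Gen a) = g a"
| "eval_bterm g J (Neg s) = - eval_bterm g J s"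
| "eval_bterm g J (Conj s t) = inf (eval_bterm g J s) (eval_bterm g J t)"
| "eval_bterm g J (Join s) = J (\<lambda>k. eval_bterm g J (s k))"

lemma eval_bterm_mono:
  fixes g :: "'a::frame \<Rightarrow> 'c::boolean_algebra"
  assumes J: "\<And>s k. s k \<le> J s" "\<And>s t. (\<And>k. s k \<le> t) \<Longrightarrow> J s \<le> t"
    and g: "g top = top" "\<And>a b. g (inf a b) = inf (g a) (g b)"
      "\<And>A t. (\<And>a. a \<in> A \<Longrightarrow> g a \<le> t) \<Longrightarrow> g (Sup A) \<le> t"
  shows "entails s t \<Longrightarrow> eval_bterm g J s \<le> eval_bterm g J t"
proof (induct rule: entails.induct)
  case (ent_negI u s)
  have "g bot \<le> bot" using g(3)[of "{}" bot] by simp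
  with ent_negI have "inf (eval_bterm g J u) (eval_bterm g J s) \<le> bot" by (auto intro: order_trans)
  then show ?case by (simp add: shunt1)
next
  case (ent_gen_mono a b)
  then show ?case using g(2)[of a b] by (simp add: inf.absorb1 le_iff_inf)
next
  case (ent_join_least s t)
  then show ?case by (auto intro: J(2))
next
  case (ent_gen_Sup A t)
  then show ?case by (auto intro: g(3))
qed (auto simp: g(1,2) intro: J(1)[of "\<lambda>k. eval_bterm g J (_ k)"] order_trans)

lemma borel_extension:
  fixes g :: "'a::frame \<Rightarrow> 'c::boolean_algebra" and J :: "('k \<Rightarrow> 'c) \<Rightarrow> 'c"
  assumes "\<And>s k. s k \<le> J s" "\<And>s t. (\<And>k. s k \<le> t) \<Longrightarrow> J s \<le> t"
    and "g top = top" "\<And>a b. g (inf a b) = inf (g a) (g b)"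
      "\<And>A t. (\<And>a. a \<in> A \<Longrightarrow> g a \<le> t) \<Longrightarrow> g (Sup A) \<le> t"
  shows "\<exists>!p :: ('a, 'k) borel \<Rightarrow> 'c. (\<forall>a. p (gen a) = g a) \<and> (\<forall>x. p (- x) = - p x) \<and>
    (\<forall>x y. p (inf x y) = inf (p x) (p y)) \<and> (\<forall>s. p (join s) = J (\<lambda>k. p (s k)))"
proof (rule ex1I)
  define p where "p x = eval_bterm g J (rep_borel x)" for x :: "('a, 'k) borel"
  have eq: "eval_bterm g J s = eval_bterm g J t" if "entails s t" "entails t s"
    for s t :: "('a, 'k) bterm"
    by (rule antisym) (intro eval_bterm_mono[OF assms] that; assumption)+
  have p: "p (abs_borel s) = eval_bterm g J s" for s
    unfolding p_def
    by (rule eq) (metis (no_types, lifting) Quotient3_borel Quotient3_def ent_refl)+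
  show pall: "(\<forall>a. p (gen a) = g a) \<and> (\<forall>x. p (- x) = - p x) \<and>
    (\<forall>x y. p (inf x y) = inf (p x) (p y)) \<and> (\<forall>s. p (join s) = J (\<lambda>k. p (s k)))"
  proof (intro conjI allI)
    show "p (gen a) = g a" for a by (simp add: gen.abs_eq p)
    show "p (- x) = - p x" for x
      by (induct x rule: borel.abs_induct) (simp add: uminus_borel.abs_eq p)
    show "p (inf x y) = inf (p x) (p y)" for x y
      by (induct x rule: borel.abs_induct, induct y rule: borel.abs_induct)
         (simp add: inf_borel.abs_eq p)
    show "p (join s) = J (\<lambda>k. p (s k))" for s
    proof -
      have s: "s = (\<lambda>k. abs_borel (rep_borel (s k)))"
        by (simp add: Quotient3_abs_rep[OF Quotient3_borel])
      have "join s = abs_borel (Join (\<lambda>k. rep_borel (s k)))"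
        by (subst s) (rule join_abs)
      then show ?thesis by (simp add: p) (simp add: p_def)
    qed
  qed
  fix q :: "('a, 'k) borel \<Rightarrow> 'c"
  assume q: "(\<forall>a. q (gen a) = g a) \<and> (\<forall>x. q (- x) = - q x) \<and>
    (\<forall>x y. q (inf x y) = inf (q x) (q y)) \<and> (\<forall>s. q (join s) = J (\<lambda>k. q (s k)))"
  have pq: "p (gen a) = g a" "p (- x) = - p x" "p (inf x y) = inf (p x) (p y)"
     "p (join s) = J (\<lambda>k. p (s k))" for a x y s
    using pall by blast+
  show "q = p"
  proof
    show "q x = p x" for x by (induct x rule: borel_induct) (use q pq in simp_all)
  qed
qed

theorem borel_free:
  fixes g :: "'a::frame \<Rightarrow> 'c::{boolean_algebra, complete_lattice}"
  assumes "g top = top" "\<And>a b. g (inf a b) = inf (g a) (g b)" "\<And>A. g (Sup A) = Sup (g ` A)"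
  shows "\<exists>!p :: ('a, 'k) borel \<Rightarrow> 'c. (\<forall>a. p (gen a) = g a) \<and> (\<forall>x. p (- x) = - p x) \<and>
    (\<forall>x y. p (inf x y) = inf (p x) (p y)) \<and> (\<forall>s. p (join s) = (SUP k. p (s k)))"
  by (rule borel_extension) (auto simp: assms intro: SUP_upper SUP_least)

theorem gen_inject: "gen a = (gen b :: ('a::frame, 'k) borel) \<longleftrightarrow> a = b"
proof -
  have le: "u \<le> c" if ent: "entails (Gen u) (Gen c :: ('a, 'k) bterm)" for u c :: 'a
  proof -
    define N where "N x = Sup {y. inf y x \<le> c}" for x
    have N: "y \<le> N x \<longleftrightarrow> inf y x \<le> c" for x y
    proof
      assume "y \<le> N x"
      then have "inf y x \<le> inf x (N x)" by (simp add: le_infI1)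
      also have "\<dots> \<le> c"
        unfolding N_def inf_Sup_distrib by (auto intro!: Sup_least simp: inf.commute)
      finally show "inf y x \<le> c" .
    qed (auto simp: N_def intro: Sup_upper)
    have anti: "x \<le> y \<Longrightarrow> N y \<le> N x" for x y
      unfolding N by (rule order_trans[OF inf_mono[OF order_refl] N[THEN iffD1, OF order_refl]])
    have NN: "x \<le> N (N x)" for x using N[of "N x" x] N[of x "N x"] by (simp add: inf.commute)
    have NNN: "N (N (N x)) = N x" for x by (rule antisym[OF anti[OF NN] NN])
    have mon: "x \<le> y \<Longrightarrow> N (N x) \<le> N (N y)" for x y by (intro anti)
    have Nc: "N (N x) = c" if "x \<le> c" for x
    proof -
      have "N x = top" using that by (intro top_le) (simp add: N)
      moreover have "N top \<le> c" using N[of "N top" top] by simp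
      moreover have "c \<le> N top" by (simp add: N)
      ultimately show ?thesis by (simp add: antisym)
    qed
    define ev :: "('a, 'k) bterm \<Rightarrow> 'a" where
      "ev = rec_bterm (\<lambda>a. N (N a)) (\<lambda>_ x. N x) (\<lambda>_ _ x y. inf x y) (\<lambda>f. N (N (SUP k. snd (f k))))"
    have [simp]: "ev (Gen a) = N (N a)" "ev (Neg s) = N (ev s)"
      "ev (Conj s t) = inf (ev s) (ev t)" "ev (Join f) = N (N (SUP k. ev (f k)))" for a s t f
      by (simp_all add: ev_def comp_def)
    have fix_ev: "N (N (ev s)) = ev s" for s
    proof (induct s)
      case (Conj s t)
      have "N (N (inf (ev s) (ev t))) \<le> inf (N (N (ev s))) (N (N (ev t)))"
        by (simp add: mon)
      then show ?case using Conj by (auto intro: antisym NN)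
    qed (simp_all add: NNN)
    have "ev s \<le> ev t" if "entails s t" for s t
      using that
    proof (induct rule: entails.induct)
      case (ent_contr s)
      show ?case using N[of "N (ev s)" "ev s"] by (simp add: Nc inf.commute)
    next
      case (ent_negI u s)
      then show ?case by (simp add: N Nc)
    next
      case (ent_dneg s)
      show ?case by (simp add: fix_ev)
    next
      case (ent_join_upper s k)
      have "ev (s k) \<le> (SUP k. ev (s k))" by (rule SUP_upper) simp
      then show ?case using NN order_trans by fastforce
    next
      case (ent_join_least s t)
      then have "(SUP k. ev (s k)) \<le> ev t" by (auto intro: SUP_least)
      from mon[OF this] show ?case by (simp add: fix_ev)
    next
      case (ent_gen_mono a b)
      then show ?case by (simp add: mon)
    next
      case (ent_gen_top s)
      have "N (N top) = top" using NN[of top] by (simp add: top_unique)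
      then show ?case by simp
    next
      case (ent_gen_inf a b)
      let ?w = "N (inf a b)"
      have "inf (inf ?w a) b \<le> c" using N[of ?w "inf a b"] by (simp add: inf.assoc)
      then have "inf ?w a \<le> N b" by (simp add: N)
      then have "inf (inf ?w a) (N (N b)) \<le> c" using N[of "inf ?w a" "N (N b)"] NNN by simp
      then have "inf ?w (N (N b)) \<le> N a" by (simp add: N inf_aci)
      then have "inf (inf ?w (N (N b))) (N (N a)) \<le> c"
        using N[of "inf ?w (N (N b))" "N (N a)"] NNN by simp
      then show ?case by (simp add: N inf_aci)
    next
      case (ent_gen_Sup A t)
      then have "Sup A \<le> ev t" by (auto intro!: Sup_least intro: order_trans[OF NN])
      from mon[OF this] show ?case by (simp add: fix_ev)
    qed (auto intro: order_trans le_infI1 le_infI2)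
    from this[OF ent] show ?thesis using NN[of u] by (auto simp: Nc intro: order_trans)
  qed
  show ?thesis
  proof
    assume "gen a = (gen b :: ('a, 'k) borel)"
    then have "entails (Gen a) (Gen b :: ('a, 'k) bterm)" "entails (Gen b) (Gen a :: ('a, 'k) bterm)"
      by (transfer; blast)+
    then show "a = b" using le by (blast intro: antisym)
  qed simp
qed


section \<open>Infinitary Borel maps\<close>

(* A complete Boolean homomorphism, viewed as a map of locales in the opposite direction.
   Preservation of bot, top and sup follows from that of inf and complements. If 'a injects into 'k,
   then p \<circ> gen preserves all joins of the frame 'a, so p extends uniquely to all larger stages;
   conversely every complete homomorphism between the full algebras restricts to all large
   enough stages and is determined by such a restriction. *)
definition borel_map :: "(('a::frame, 'k) borel \<Rightarrow> ('b::frame, 'k) borel) \<Rightarrow> bool" where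
  "borel_map p \<longleftrightarrow>
     (\<forall>x y. p (inf x y) = inf (p x) (p y)) \<and> (\<forall>x. p (- x) = - p x) \<and>
     (\<forall>s. p (join s) = join (\<lambda>k. p (s k)))"

(* The Borel map induced by a continuous map with inverse image h. *)
definition borel_of :: "('a::frame \<Rightarrow> 'b::frame) \<Rightarrow> ('a, 'k) borel \<Rightarrow> ('b, 'k) borel" where
  "borel_of h = (THE p. borel_map p \<and> (\<forall>a. p (gen a) = gen (h a)))"

(* Inverse image along the product map f \<times> g : X \<times> X' \<rightarrow> Y \<times> Y' of Borel maps, characterised by
   its composites with the two projections. *)
definition borel_prod ::
    "(('c::frame, 'k) borel \<Rightarrow> ('a::frame, 'k) borel) \<Rightarrow>
     (('d::frame, 'k) borel \<Rightarrow> ('b::frame, 'k) borel) \<Rightarrow>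
     (('c, 'd) tensor, 'k) borel \<Rightarrow> (('a, 'b) tensor, 'k) borel" where
  "borel_prod f g = (THE p. borel_map p \<and>
     p \<circ> borel_of proj1 = borel_of proj1 \<circ> f \<and> p \<circ> borel_of proj2 = borel_of proj2 \<circ> g)"

definition borel_group_hom ::
    "('g::frame \<Rightarrow> ('g, 'g) tensor) \<Rightarrow> ('g \<Rightarrow> bool) \<Rightarrow> ('g \<Rightarrow> 'g) \<Rightarrow>
     ('h::frame \<Rightarrow> ('h, 'h) tensor) \<Rightarrow> ('h \<Rightarrow> bool) \<Rightarrow> ('h \<Rightarrow> 'h) \<Rightarrow>
     (('h, 'k) borel \<Rightarrow> ('g, 'k) borel) \<Rightarrow> bool" where
  "borel_group_hom mG eG iG mH eH iH f \<longleftrightarrow>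
     borel_map f \<and>
     borel_of mG \<circ> f = borel_prod f f \<circ> borel_of mH \<and>
     borel_of eG \<circ> f = borel_of eH \<and>
     borel_of iG \<circ> f = f \<circ> borel_of iH"

lemma borel_map_eqI:
  assumes "borel_map p" "borel_map q" "\<And>a. p (gen a) = q (gen a)"
  shows "p = q"
proof
  show "p x = q x" for x
    by (induct x rule: borel_induct) (use assms in \<open>simp_all add: borel_map_def\<close>)
qed

lemma borel_map_extension:
  fixes g :: "'a::frame \<Rightarrow> ('b::frame, 'k) borel"
  assumes "g top = top" "\<And>a b. g (inf a b) = inf (g a) (g b)"
    "\<And>A t. (\<And>a. a \<in> A \<Longrightarrow> g a \<le> t) \<Longrightarrow> g (Sup A) \<le> t"
  shows "\<exists>p. borel_map p \<and> (\<forall>a. p (gen a) = g a)"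
proof -
  have "\<exists>!p :: ('a, 'k) borel \<Rightarrow> ('b, 'k) borel.
      (\<forall>a. p (gen a) = g a) \<and> (\<forall>x. p (- x) = - p x) \<and>
      (\<forall>x y. p (inf x y) = inf (p x) (p y)) \<and> (\<forall>s. p (join s) = join (\<lambda>k. p (s k)))"
    by (rule borel_extension) (use assms in \<open>blast intro: join_upper join_least\<close>)+
  then obtain p where "\<forall>a. p (gen a) = g a" "\<forall>x. p (- x) = - p x"
    "\<forall>x y. p (inf x y) = inf (p x) (p y)" "\<forall>s. p (join s) = join (\<lambda>k. p (s k))"
    by (elim ex1E) blast
  then show ?thesis by (auto simp: borel_map_def)
qed

lemma borel_of:
  fixes h :: "'a::frame \<Rightarrow> 'b::frame"
  assumes h: "frame_hom h"
  shows borel_map_borel_of: "borel_map (borel_of h :: ('a, 'k) borel \<Rightarrow> ('b, 'k) borel)"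
    and borel_of_gen: "borel_of h (gen a) = (gen (h a) :: ('b, 'k) borel)"
proof -
  have "\<exists>p :: ('a, 'k) borel \<Rightarrow> ('b, 'k) borel. borel_map p \<and> (\<forall>a. p (gen a) = gen (h a))"
  proof (rule borel_map_extension)
    show "gen (h top) = (top :: ('b, 'k) borel)"
      and "gen (h (inf a b)) = (inf (gen (h a)) (gen (h b)) :: ('b, 'k) borel)" for a b
      using h by (simp_all add: frame_hom_def gen_top gen_inf)
    fix A and t :: "('b, 'k) borel"
    assume "\<And>a. a \<in> A \<Longrightarrow> gen (h a) \<le> t"
    moreover have "h (Sup A) = Sup (h ` A)" using h by (simp add: frame_hom_def)
    ultimately show "gen (h (Sup A)) \<le> t" by (auto intro: gen_Sup_least)
  qed
  then have "\<exists>!p :: ('a, 'k) borel \<Rightarrow> ('b, 'k) borel. borel_map p \<and> (\<forall>a. p (gen a) = gen (h a))"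
    by (auto intro: borel_map_eqI)
  from theI'[OF this] show "borel_map (borel_of h :: ('a, 'k) borel \<Rightarrow> ('b, 'k) borel)"
    "borel_of h (gen a) = (gen (h a) :: ('b, 'k) borel)"
    unfolding borel_of_def by blast+
qed

lemma borel_map_simps:
  assumes "borel_map p"
  shows "p (inf x y) = inf (p x) (p y)" "p (- x) = - p x" "p (join s) = join (\<lambda>k. p (s k))"
    and "p bot = bot" "p top = top"
proof -
  show 1: "p (inf x y) = inf (p x) (p y)" "p (- x) = - p x" "p (join s) = join (\<lambda>k. p (s k))"
    for x y s using assms by (simp_all add: borel_map_def)
  show 2: "p bot = bot" using 1(1)[of bot "- bot"] 1(2)[of bot] by simp
  show "p top = top" using 1(2)[of bot] 2 by simp
qed

lemma borel_map_comp: "borel_map p \<Longrightarrow> borel_map q \<Longrightarrow> borel_map (q \<circ> p)"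
  by (simp add: borel_map_def)

lemma borel_map_mono: "borel_map p \<Longrightarrow> x \<le> y \<Longrightarrow> p x \<le> p y"
  by (metis borel_map_simps(1) inf.absorb_iff1)

lemma borel_map_gen_Sup:
  fixes p :: "('a::frame, 'k) borel \<Rightarrow> ('b::frame, 'k) borel" and \<iota> :: "'a \<Rightarrow> 'k"
  assumes p: "borel_map p" and "inj \<iota>" and le: "\<And>a. a \<in> A \<Longrightarrow> p (gen a) \<le> t"
  shows "p (gen (Sup A)) \<le> t"
proof -
  let ?s = "\<lambda>k. if k \<in> \<iota> ` A then gen (inv \<iota> k) else bot :: ('a, 'k) borel"
  have "gen a \<le> join ?s" if "a \<in> A" for a
    using join_upper[of ?s "\<iota> a"] that \<open>inj \<iota>\<close> by simp
  then have "gen (Sup A) \<le> join ?s" by (rule gen_Sup_least)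
  then have "p (gen (Sup A)) \<le> join (\<lambda>k. p (?s k))"
    using borel_map_mono[OF p] borel_map_simps(3)[OF p] by metis
  also have "\<dots> \<le> t"
    by (rule join_least) (use le \<open>inj \<iota>\<close> borel_map_simps(4)[OF p] in auto)
  finally show ?thesis .
qed

theorem borel_prod_ex1:
  fixes f :: "('c::frame, 'k) borel \<Rightarrow> ('a::frame, 'k) borel"
    and g :: "('d::frame, 'k) borel \<Rightarrow> ('b::frame, 'k) borel"
  assumes f: "borel_map f" and g: "borel_map g"
    and "\<exists>\<iota> :: 'c \<Rightarrow> 'k. inj \<iota>" "\<exists>\<kappa> :: 'd \<Rightarrow> 'k. inj \<kappa>"
  shows "\<exists>!p. borel_map p \<and>
     p \<circ> borel_of proj1 = borel_of proj1 \<circ> f \<and> p \<circ> borel_of proj2 = borel_of proj2 \<circ> g"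
proof -
  obtain \<iota> :: "'c \<Rightarrow> 'k" and \<kappa> :: "'d \<Rightarrow> 'k" where inj: "inj \<iota>" "inj \<kappa>" using assms by blast
  let ?u = "borel_of proj1 \<circ> f :: ('c, 'k) borel \<Rightarrow> (('a, 'b) tensor, 'k) borel"
  let ?v = "borel_of proj2 \<circ> g :: ('d, 'k) borel \<Rightarrow> (('a, 'b) tensor, 'k) borel"
  have u: "borel_map ?u" and v: "borel_map ?v"
    by (intro borel_map_comp f g borel_map_borel_of frame_hom_proj1 frame_hom_proj2)+
  define \<phi> where "\<phi> a = ?u (gen a)" for a
  define \<psi> where "\<psi> b = ?v (gen b)" for b
  have hom: "\<phi> (inf a a') = inf (\<phi> a) (\<phi> a')" "\<psi> (inf b b') = inf (\<psi> b) (\<psi> b')"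
    "\<phi> top = top" "\<psi> top = top" "\<phi> bot = bot" "\<psi> bot = bot" for a a' b b'
    unfolding \<phi>_def \<psi>_def gen_inf gen_top gen_bot
    by (rule borel_map_simps[OF u] borel_map_simps[OF v])+
  have mono: "mono \<phi>" "mono \<psi>"
    using borel_map_mono[OF u gen_mono] borel_map_mono[OF v gen_mono]
    by (auto simp: \<phi>_def \<psi>_def intro!: monoI)
  have Sup: "\<phi> (Sup A) \<le> t" if "\<And>a. a \<in> A \<Longrightarrow> \<phi> a \<le> t" for A t
    using borel_map_gen_Sup[OF u inj(1)] that unfolding \<phi>_def by blast
  have Sup': "\<psi> (Sup A) \<le> t" if "\<And>a. a \<in> A \<Longrightarrow> \<psi> a \<le> t" for A t
    using borel_map_gen_Sup[OF v inj(2)] that unfolding \<psi>_def by blast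
  define L where "L D = join (\<lambda>k. join (\<lambda>l.
      if k \<in> range \<iota> \<and> l \<in> range \<kappa> \<and> (inv \<iota> k, inv \<kappa> l) \<in> rects D
      then inf (\<phi> (inv \<iota> k)) (\<psi> (inv \<kappa> l)) else bot))" for D
  have ub: "inf (\<phi> a) (\<psi> b) \<le> L D" if "(a, b) \<in> rects D" for a b D
    unfolding L_def
    by (rule order_trans[OF _ join_upper[of _ "\<iota> a"]], rule order_trans[OF _ join_upper[of _ "\<kappa> b"]])
       (use that inj in simp)
  have least: "L D \<le> t" if "\<And>a b. (a, b) \<in> rects D \<Longrightarrow> inf (\<phi> a) (\<psi> b) \<le> t" for D t
    unfolding L_def by (intro join_least) (auto intro: that)
  have rect: "L (rect a b) = inf (\<phi> a) (\<psi> b)" for a b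
  proof (rule antisym)
    show "L (rect a b) \<le> inf (\<phi> a) (\<psi> b)"
      by (rule least)
         (auto simp: rects_rect hom intro: le_infI1 le_infI2 monoD[OF mono(1)] monoD[OF mono(2)])
    show "inf (\<phi> a) (\<psi> b) \<le> L (rect a b)" by (rule ub) (simp add: rects_rect)
  qed
  have Lmono: "L D \<le> L E" if "D \<le> E" for D E
    by (rule least) (use that in \<open>auto simp: less_eq_tensor.rep_eq intro: ub\<close>)
  have "\<exists>p. borel_map p \<and> (\<forall>D. p (gen D) = L D)"
  proof (rule borel_map_extension)
    show "L top = top" using rect[of top top] by (simp add: rect_top hom)
    show "L (inf D E) = inf (L D) (L E)" for D E
    proof (rule antisym)
      show "L (inf D E) \<le> inf (L D) (L E)" by (simp add: Lmono)
      have 1: "inf (inf (\<phi> a) (\<psi> b)) (inf (\<phi> c) (\<psi> d)) \<le> L (inf D E)"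
        if "(a, b) \<in> rects D" "(c, d) \<in> rects E" for a b c d
      proof -
        have "(inf a c, inf b d) \<in> rects (inf D E)"
          using C_ideal_down[OF C_ideal_rects that(1)] C_ideal_down[OF C_ideal_rects that(2)]
          by (simp add: inf_tensor.rep_eq)
        from ub[OF this] show ?thesis by (simp add: hom inf_aci)
      qed
      have 2: "inf (inf (\<phi> a) (\<psi> b)) (L E) \<le> L (inf D E)" if "(a, b) \<in> rects D" for a b
      proof -
        have "L E \<le> sup (- inf (\<phi> a) (\<psi> b)) (L (inf D E))"
          by (rule least) (use 1[OF that] in \<open>simp only: shunt1[symmetric] inf.commute\<close>)
        then show ?thesis by (simp only: shunt1[symmetric] inf.commute)
      qed
      have "L D \<le> sup (- L E) (L (inf D E))"
        by (rule least) (use 2 in \<open>simp only: shunt1[symmetric]\<close>)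
      then show "inf (L D) (L E) \<le> L (inf D E)" by (simp only: shunt1)
    qed
    show "L (Sup \<D>) \<le> t" if le: "\<And>D. D \<in> \<D> \<Longrightarrow> L D \<le> t" for \<D> t
    proof -
      have "rects (Sup \<D>) \<subseteq> {(a, b). inf (\<phi> a) (\<psi> b) \<le> t}"
      proof (intro rects_Sup_below C_ideal_below mono)
        show "inf (\<phi> (Sup A)) y \<le> t" if "\<And>a. a \<in> A \<Longrightarrow> inf (\<phi> a) y \<le> t" for A y
          using that Sup unfolding shunt1 by blast
        show "inf (\<psi> (Sup A)) y \<le> t" if "\<And>a. a \<in> A \<Longrightarrow> inf (\<psi> a) y \<le> t" for A y
          using that Sup' unfolding shunt1 by blast
      qed (use le ub in \<open>blast intro: order_trans\<close>)
      then show ?thesis by (intro least) auto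
    qed
  qed
  then obtain p where p: "borel_map p" "\<And>D. p (gen D) = L D" by blast
  show ?thesis
  proof (rule ex1I, intro conjI)
    show "borel_map p" by (rule p)
    show "p \<circ> borel_of proj1 = ?u"
      by (rule borel_map_eqI[OF borel_map_comp[OF borel_map_borel_of[OF frame_hom_proj1] p(1)] u])
         (simp add: borel_of_gen frame_hom_proj1 p proj1_def rect hom \<phi>_def[symmetric, unfolded comp_def])
    show "p \<circ> borel_of proj2 = ?v"
      by (rule borel_map_eqI[OF borel_map_comp[OF borel_map_borel_of[OF frame_hom_proj2] p(1)] v])
         (simp add: borel_of_gen frame_hom_proj2 p proj2_def rect hom \<psi>_def[symmetric, unfolded comp_def])
    fix q assume q: "borel_map q \<and> q \<circ> borel_of proj1 = ?u \<and> q \<circ> borel_of proj2 = ?v"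
    have q1: "q (gen (proj1 a)) = \<phi> a" and q2: "q (gen (proj2 b)) = \<psi> b" for a b
      using q by (auto simp: \<phi>_def \<psi>_def borel_of_gen[OF frame_hom_proj1, symmetric]
          borel_of_gen[OF frame_hom_proj2, symmetric] fun_eq_iff)
    have qr: "q (gen (rect a b)) = inf (\<phi> a) (\<psi> b)" for a b
      using q borel_map_simps(1)[of q] by (simp add: rect_eq_inf gen_inf q1 q2)
    show "q = p"
    proof (rule borel_map_eqI)
      show "borel_map q" "borel_map p" using q p by auto
      fix D
      let ?s = "\<lambda>k. join (\<lambda>l. if k \<in> range \<iota> \<and> l \<in> range \<kappa> \<and> (inv \<iota> k, inv \<kappa> l) \<in> rects D
          then gen (rect (inv \<iota> k) (inv \<kappa> l)) else bot :: (('c, 'd) tensor, 'k) borel)"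
      have "gen D = join ?s"
      proof (rule antisym)
        have "gen (rect a b) \<le> join ?s" if "(a, b) \<in> rects D" for a b
          by (rule order_trans[OF _ join_upper[of _ "\<iota> a"]],
              rule order_trans[OF _ join_upper[of _ "\<kappa> b"]]) (use that inj in simp)
        then have "gen (SUP (a, b)\<in>rects D. rect a b) \<le> join ?s"
          by (intro gen_Sup_least) auto
        then show "gen D \<le> join ?s" using tensor_eq_Sup_rect[of D] by simp
        show "join ?s \<le> gen D"
          by (intro join_least) (auto intro: gen_mono simp: rect_le_iff)
      qed
      moreover have "q (join ?s) = L D"
        unfolding L_def using q
        by (auto simp: borel_map_simps(3)[of q] borel_map_simps(4)[of q] qr if_distrib[of q] cong: if_cong)
      ultimately show "q (gen D) = p (gen D)" using p(2)[of D] by simp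
    qed
  qed
qed

end

theory Submission
  imports Defs
begin

text \<open>
  This is a pointfree form of the theorem of Pettis, by forcing. Let R be the Boolean completion of
  the Borel algebra of G, let T be the coproduct of the frames O(G) and R, and let Q be the Boolean
  completion of T. Over Q there are two generalised points of G: x, whose inverse image is the first
  injection, so that it lies in every dense open set, and y, induced by the second injection, whose
  inverse image is injective on Borel sets. The automorphism (x, y) \<open>\<mapsto>\<close> (x\<open>\<^sup>-\<^sup>1\<close>y, y) of T
  preserves density, so x\<open>\<^sup>-\<^sup>1\<close>y lies in every dense open set as well. On points in all
  dense open sets every Borel set agrees with an open one. From f(y) = f(x) f(x\<open>\<^sup>-\<^sup>1\<close>y) it
  follows that ``f(y) is in V'' is an open condition W on the pair (x, y), and therefore
  the preimage of V under f is the image of W under the second projection, which is an open map.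
\<close>

section \<open>Boolean completions\<close>

text \<open>The polarity of the symmetric relation \<open>inf x y = bot\<close>. It is an antitone
  Galois connection of the power set with itself, so on its closed sets it acts as an involution,
  which becomes the complement.\<close>

definition annih :: "'a::bounded_lattice_bot set \<Rightarrow> 'a set" where
  "annih S = {x. \<forall>y\<in>S. inf x y = bot}"

lemma annih_anti: "S \<subseteq> T \<Longrightarrow> annih T \<subseteq> annih S"
  by (auto simp: annih_def)

lemma subset_annih_annih: "S \<subseteq> annih (annih S)"
  by (auto simp: annih_def inf.commute)

lemma annih_annih_annih [simp]: "annih (annih (annih S)) = annih S"
  by (intro antisym annih_anti subset_annih_annih)

lemma annih_Inter:
  assumes "\<And>S. S \<in> \<S> \<Longrightarrow> annih (annih S) = S"
  shows "annih (annih (\<Inter>\<S>)) = \<Inter>\<S>"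
proof (rule antisym[OF _ subset_annih_annih])
  show "annih (annih (\<Inter>\<S>)) \<subseteq> \<Inter>\<S>"
  proof (rule Inter_greatest)
    fix S assume "S \<in> \<S>"
    then have "annih (annih (\<Inter>\<S>)) \<subseteq> annih (annih S)" by (intro annih_anti Inter_lower)
    then show "annih (annih (\<Inter>\<S>)) \<subseteq> S" using assms[OF \<open>S \<in> \<S>\<close>] by simp
  qed
qed

lemma annih_down: "x \<in> annih S \<Longrightarrow> y \<le> x \<Longrightarrow> y \<in> annih S"
  unfolding annih_def by (smt (verit) inf.absorb_iff1 inf.assoc inf_bot_right mem_Collect_eq)

text \<open>
  The elements are the annihilators. For a frame they amount to the regular opens, for a Boolean
  algebra this is the MacNeille completion.
\<close>

typedef (overloaded) 'a completion = "{S :: 'a::bounded_lattice_bot set. annih (annih S) = S}"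
  morphisms members Abs_completion
  by (rule exI[of _ "annih {}"]) simp

setup_lifting type_definition_completion

lemma annih_annih_members: "annih (annih (members X)) = members X"
  using members by simp

lemma members_down: "x \<in> members X \<Longrightarrow> y \<le> x \<Longrightarrow> y \<in> members X"
  using annih_down[of x "annih (members X)" y] by (simp add: annih_annih_members)

lemma bot_in_annih: "bot \<in> annih S"
  by (simp add: annih_def)

instantiation completion :: (bounded_lattice_bot) boolean_algebra
begin

lift_definition less_eq_completion :: "'a completion \<Rightarrow> 'a completion \<Rightarrow> bool" is "(\<subseteq>)" .
lift_definition less_completion :: "'a completion \<Rightarrow> 'a completion \<Rightarrow> bool" is "(\<subset>)" .
lift_definition inf_completion :: "'a completion \<Rightarrow> 'a completion \<Rightarrow> 'a completion" is "(\<inter>)"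
proof -
  fix S T :: "'a set" assume "annih (annih S) = S" "annih (annih T) = T"
  then show "annih (annih (S \<inter> T)) = S \<inter> T" using annih_Inter[of "{S, T}"] by auto
qed
lift_definition uminus_completion :: "'a completion \<Rightarrow> 'a completion" is annih
  by simp
lift_definition top_completion :: "'a completion" is UNIV
  using subset_annih_annih by blast
lift_definition bot_completion :: "'a completion" is "annih UNIV"
  by simp
definition sup_completion :: "'a completion \<Rightarrow> 'a completion \<Rightarrow> 'a completion" where
  "sup_completion X Y = - inf (- X) (- Y)"
definition minus_completion :: "'a completion \<Rightarrow> 'a completion \<Rightarrow> 'a completion" where
  "minus_completion X Y = inf X (- Y)"

instance
proof -
  have refl: "x \<le> x" for x :: "'a completion" by transfer auto
  have trans: "x \<le> y \<Longrightarrow> y \<le> z \<Longrightarrow> x \<le> z" for x y z :: "'a completion" by transfer auto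
  have anti: "x \<le> y \<Longrightarrow> y \<le> x \<Longrightarrow> x = y" for x y :: "'a completion" by transfer auto
  have inf1: "inf x y \<le> x" and inf2: "inf x y \<le> y" for x y :: "'a completion"
    by (transfer, auto)+
  have infI: "z \<le> x \<Longrightarrow> z \<le> y \<Longrightarrow> z \<le> inf x y" for x y z :: "'a completion"
    by transfer auto
  have bot: "bot \<le> x" for x :: "'a completion"
    using annih_anti[of "annih (members x)" UNIV]
    by (simp add: less_eq_completion.rep_eq bot_completion.rep_eq annih_annih_members)
  have top: "x \<le> top" for x :: "'a completion" by transfer auto
  have neg: "x \<le> - y \<longleftrightarrow> inf x y \<le> bot" for x y :: "'a completion"
  proof
    assume "x \<le> - y"
    then show "inf x y \<le> bot"
      unfolding less_eq_completion.rep_eq uminus_completion.rep_eq inf_completion.rep_eq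
        bot_completion.rep_eq by (fastforce simp: annih_def)
  next
    assume le: "inf x y \<le> bot"
    have "inf a b = bot" if "a \<in> members x" "b \<in> members y" for a b
    proof -
      have "inf a b \<in> members (inf x y)"
        using members_down[OF that(1)] members_down[OF that(2)] by (simp add: inf_completion.rep_eq)
      then have "inf a b \<in> annih UNIV"
        using le by (auto simp: less_eq_completion.rep_eq bot_completion.rep_eq)
      then show ?thesis by (simp add: annih_def) (metis inf.idem)
    qed
    then show "x \<le> - y"
      by (auto simp: less_eq_completion.rep_eq uminus_completion.rep_eq annih_def)
  qed
  have dneg: "- (- x) = x" for x :: "'a completion" by transfer
  have comm: "inf x y = inf y x" for x y :: "'a completion" by transfer auto
  have neg_mono: "x \<le> y \<Longrightarrow> - y \<le> - x" for x y :: "'a completion"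
    by transfer (rule annih_anti)
  have neg_swap: "- x \<le> y \<Longrightarrow> - y \<le> x" for x y :: "'a completion"
    using neg_mono[of "- x" y] by (simp add: dneg)
  have sup1: "x \<le> sup x y" and sup2: "y \<le> sup x y" for x y :: "'a completion"
    unfolding sup_completion_def using neg_mono[OF inf1, of "- x" "- y"] neg_mono[OF inf2, of "- y" "- x"]
    by (simp_all add: dneg)
  have supl: "sup x y \<le> z" if "x \<le> z" "y \<le> z" for x y z :: "'a completion"
    unfolding sup_completion_def by (rule neg_swap[OF infI[OF neg_mono[OF that(1)] neg_mono[OF that(2)]]])
  \<comment> \<open>The underlying lattice may fail to be distributive. Distributivity of the
    completion comes from \<open>neg\<close> and \<open>dneg\<close>: an inequality
    \<open>inf a w \<le> t\<close> turns into the upper bound \<open>- inf a (- t)\<close> of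
    \<open>w\<close>.\<close>
  have res: "inf a (sup y z) \<le> t" if "inf a y \<le> t" "inf a z \<le> t" for a y z t :: "'a completion"
  proof -
    have contr: "inf t (- t) \<le> bot" using neg[of t "- t"] refl by (simp add: dneg)
    have *: "w \<le> - inf a (- t)" if "inf a w \<le> t" for w
    proof -
      have "inf w (inf a (- t)) \<le> t"
        by (rule trans[OF infI[OF trans[OF inf2 inf1] inf1] that])
      then have "inf w (inf a (- t)) \<le> inf t (- t)" by (rule infI[OF _ trans[OF inf2 inf2]])
      then show ?thesis unfolding neg by (rule trans[OF _ contr])
    qed
    have "sup y z \<le> - inf a (- t)" by (intro supl * that)
    then have "inf (sup y z) (inf a (- t)) \<le> bot" by (simp only: neg)
    then have "inf (inf a (sup y z)) (- t) \<le> bot"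
      by (rule trans[OF infI[OF trans[OF inf1 inf2] infI[OF trans[OF inf1 inf1] inf2]]])
    then show ?thesis by (simp only: neg[of _ "- t", unfolded dneg])
  qed
  show "OFCLASS('a completion, boolean_algebra_class)"
  proof
    fix x y z :: "'a completion"
    show "x < y \<longleftrightarrow> x \<le> y \<and> \<not> y \<le> x" by transfer auto
    show "x \<le> x" by (rule refl)
    show "x \<le> y \<Longrightarrow> y \<le> z \<Longrightarrow> x \<le> z" by (rule trans)
    show "x \<le> y \<Longrightarrow> y \<le> x \<Longrightarrow> x = y" by (rule anti)
    show "inf x y \<le> x" "inf x y \<le> y" by (rule inf1 inf2)+
    show "x \<le> y \<Longrightarrow> x \<le> z \<Longrightarrow> x \<le> inf y z" by (rule infI)
    show "x \<le> sup x y" "y \<le> sup x y" by (rule sup1 sup2)+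
    show "y \<le> x \<Longrightarrow> z \<le> x \<Longrightarrow> sup y z \<le> x" by (rule supl)
    show "bot \<le> x" "x \<le> top" by (rule bot top)+
    have 1: "inf x (sup x z) \<le> sup x (inf y z)" by (rule trans[OF inf1 sup1])
    have "inf y (sup x z) \<le> sup x (inf y z)"
      by (rule res[OF trans[OF inf2 sup1] sup2])
    then have 2: "inf (sup x z) (sup x y) \<le> sup x (inf y z)"
      by (intro res; subst comm) (rule 1)
    show "sup x (inf y z) = inf (sup x y) (sup x z)"
    proof (rule anti)
      show "sup x (inf y z) \<le> inf (sup x y) (sup x z)"
        by (intro supl infI sup1 trans[OF inf1 sup2] trans[OF inf2 sup2])
      show "inf (sup x y) (sup x z) \<le> sup x (inf y z)" using 2 by (subst comm)
    qed
    have c: "inf (- x) x \<le> bot" for x :: "'a completion" unfolding neg[symmetric] by (rule refl)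
    show "inf x (- x) = bot" using c[of x] by (subst comm) (rule anti[OF _ bot])
    have "top \<le> - inf (- x) (- (- x))"
      unfolding neg by (rule trans[OF inf2]) (unfold dneg, rule c)
    then show "sup x (- x) = top" unfolding sup_completion_def by (rule anti[OF top])
    show "x - y = inf x (- y)" by (rule minus_completion_def)
  qed
qed

end

instantiation completion :: (bounded_lattice_bot) complete_lattice
begin

lift_definition Inf_completion :: "'a completion set \<Rightarrow> 'a completion" is Inter
  by (rule annih_Inter)
definition Sup_completion :: "'a completion set \<Rightarrow> 'a completion" where
  "Sup_completion A = - Inf (uminus ` A)"

instance
proof
  have low: "x \<in> A \<Longrightarrow> Inf A \<le> x" for x :: "'a completion" and A
    by (auto simp: less_eq_completion.rep_eq Inf_completion.rep_eq)
  have great: "(\<And>x. x \<in> A \<Longrightarrow> z \<le> x) \<Longrightarrow> z \<le> Inf A" for z :: "'a completion" and A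
    by (auto simp: less_eq_completion.rep_eq Inf_completion.rep_eq)
  fix x z :: "'a completion" and A
  show "x \<in> A \<Longrightarrow> Inf A \<le> x" by (rule low)
  show "(\<And>x. x \<in> A \<Longrightarrow> z \<le> x) \<Longrightarrow> z \<le> Inf A" by (rule great)
  show "x \<in> A \<Longrightarrow> x \<le> Sup A"
    unfolding Sup_completion_def using low[of "- x" "uminus ` A"] by (simp add: compl_le_swap1)
  show "(\<And>x. x \<in> A \<Longrightarrow> x \<le> z) \<Longrightarrow> Sup A \<le> z"
    unfolding Sup_completion_def using great[of "uminus ` A" "- z"] by (force intro: compl_le_swap2)
  show Inf: "Inf {} = (top :: 'a completion)" by transfer auto
  show "Sup {} = (bot :: 'a completion)" by (simp add: Sup_completion_def Inf)
qed

end

text \<open>In a Boolean algebra \<open>inf a\<close> has the right adjoint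
  \<open>sup (- a)\<close>, by \<open>shunt1\<close>, and therefore preserves joins.\<close>

instance completion :: (bounded_lattice_bot) frame
proof
  fix a :: "'a completion" and B
  have "b \<le> sup (- a) (Sup (inf a ` B))" if "b \<in> B" for b
    unfolding shunt1[symmetric] inf.commute[of b] using that by (intro Sup_upper imageI)
  then have "Sup B \<le> sup (- a) (Sup (inf a ` B))" by (rule Sup_least)
  then have "inf a (Sup B) \<le> Sup (inf a ` B)"
    unfolding shunt1[symmetric] inf.commute[of _ a] .
  moreover have "Sup (inf a ` B) \<le> inf a (Sup B)"
    by (intro Sup_least) (auto intro: le_infI2 Sup_upper)
  ultimately show "inf a (Sup B) = Sup (inf a ` B)" by (rule antisym)
qed

text \<open>In a frame this is the down-set of the double pseudocomplement of \<open>a\<close>, in a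
  Boolean algebra the principal ideal of \<open>a\<close>. So opens are identified up to
  regularisation in the first case, while the second gives an embedding.\<close>

lift_definition incl :: "'a::bounded_lattice_bot \<Rightarrow> 'a completion" is "\<lambda>a. annih (annih {a})"
  by simp

lemma incl_le_iff: "incl a \<le> X \<longleftrightarrow> a \<in> members X"
proof
  assume "a \<in> members X"
  then have "annih (annih {a}) \<subseteq> annih (annih (members X))" by (intro annih_anti) simp
  then show "incl a \<le> X" by (simp add: less_eq_completion.rep_eq incl.rep_eq annih_annih_members)
next
  assume "incl a \<le> X"
  then show "a \<in> members X"
    using subset_annih_annih[of "{a}"] by (auto simp: less_eq_completion.rep_eq incl.rep_eq)
qed

lemma members_incl: "x \<in> members (incl a) \<longleftrightarrow> (\<forall>y. inf a y = bot \<longrightarrow> inf x y = bot)"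
  by (auto simp: incl.rep_eq annih_def inf.commute)

lemma incl_le_incl_iff: "incl x \<le> incl a \<longleftrightarrow> (\<forall>y. inf a y = bot \<longrightarrow> inf x y = bot)"
  by (simp add: incl_le_iff members_incl)

lemma incl_inf: "incl (inf a b) = inf (incl a) (incl b)"
proof (rule antisym)
  show "incl (inf a b) \<le> inf (incl a) (incl b)"
    by (auto simp: incl_le_incl_iff) (metis inf.assoc inf.commute inf_bot_right)+
  have "x \<in> members (incl (inf a b))" if "x \<in> members (incl a)" "x \<in> members (incl b)" for x
    unfolding members_incl
  proof (intro allI impI)
    \<comment> \<open>Membership lets \<open>x\<close> replace first \<open>a\<close> and then
      \<open>b\<close>; the doubled \<open>x\<close> is absorbed.\<close>
    fix y assume "inf (inf a b) y = bot"
    then have "inf x (inf b y) = bot" using that(1) by (simp add: members_incl inf.assoc)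
    then have "inf b (inf x y) = bot" by (simp only: inf.left_commute)
    then have "inf x (inf x y) = bot" using that(2) unfolding members_incl by blast
    then show "inf x y = bot" by (simp only: inf.left_idem)
  qed
  then show "inf (incl a) (incl b) \<le> incl (inf a b)"
    by (auto simp: less_eq_completion.rep_eq inf_completion.rep_eq)
qed

definition dense :: "'a::bounded_lattice_bot \<Rightarrow> bool" where
  "dense d \<longleftrightarrow> (\<forall>y. inf d y = bot \<longrightarrow> y = bot)"

text \<open>This is what makes a point generic: if its inverse image is \<open>incl\<close>, it lies
  in every dense open set.\<close>

lemma incl_eq_top_iff: "incl a = top \<longleftrightarrow> dense a"
proof -
  have "incl a = top \<longleftrightarrow> (\<forall>x. x \<in> members (incl a))"
    by (auto simp: members_inject[symmetric] top_completion.rep_eq)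
  also have "\<dots> \<longleftrightarrow> dense a"
    unfolding members_incl dense_def by (metis inf.idem inf_bot_right)
  finally show ?thesis .
qed

lemma incl_eq_bot_iff: "incl a = bot \<longleftrightarrow> a = bot"
proof
  assume "incl a = bot"
  then have "a \<in> annih UNIV"
    using incl_le_iff[of a bot] by (simp add: bot_completion.rep_eq)
  then show "a = bot" by (simp add: annih_def) (metis inf.idem)
next
  assume "a = bot"
  then have "incl a \<le> bot" by (simp add: incl_le_iff bot_completion.rep_eq bot_in_annih)
  then show "incl a = bot" by (rule bot.extremum_uniqueI)
qed

lemma frame_hom_incl: "frame_hom (incl :: 'a::frame \<Rightarrow> 'a completion)"
  unfolding frame_hom_def
proof (intro conjI allI)
  show "incl (top :: 'a) = top" by (simp add: incl_eq_top_iff dense_def)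
  show "incl (inf a b) = inf (incl a) (incl b)" for a b :: 'a by (rule incl_inf)
  show "incl (Sup A) = Sup (incl ` A)" for A :: "'a set"
  proof (rule antisym)
    have A: "a \<in> members (Sup (incl ` A))" if "a \<in> A" for a
      unfolding incl_le_iff[symmetric] using that by (simp add: Sup_upper)
    \<comment> \<open>The frame law enters here: what is disjoint from each element of
      \<open>A\<close> is disjoint from \<open>Sup A\<close>.\<close>
    have "inf y (Sup A) = bot" if "y \<in> annih (members (Sup (incl ` A)))" for y
      unfolding inf_Sup_distrib using that A
      by (auto simp: annih_def bot_unique[symmetric] intro!: Sup_least)
    then have "Sup A \<in> annih (annih (members (Sup (incl ` A))))"
      by (auto simp: annih_def inf.commute)
    then show "incl (Sup A) \<le> Sup (incl ` A)" by (simp add: incl_le_iff annih_annih_members)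
    show "Sup (incl ` A) \<le> incl (Sup A)"
      by (intro Sup_least)
         (auto simp: incl_le_incl_iff bot_unique[symmetric] intro: order_trans[OF inf_mono[OF Sup_upper order_refl]])
  qed
qed

lemma incl_boolean_le_iff: "incl a \<le> incl b \<longleftrightarrow> a \<le> b" for a b :: "'a::boolean_algebra"
proof
  assume "incl a \<le> incl b"
  then have "inf a (- b) = bot" by (simp add: incl_le_incl_iff)
  then show "a \<le> b" by (simp add: inf_shunt)
next
  assume "a \<le> b"
  then have "inf a b = a" by (rule inf.absorb1)
  then show "incl a \<le> incl b" using incl_inf[of a b] by (simp add: inf.absorb_iff1)
qed

lemma incl_uminus: "incl (- a) = - incl a" for a :: "'a::boolean_algebra"
proof (rule antisym)
  have "inf (incl (- a)) (incl a) = bot" by (simp add: incl_inf[symmetric] incl_eq_bot_iff)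
  then show "incl (- a) \<le> - incl a" by (simp add: inf_shunt)
  have "x \<le> - a" if "x \<in> members (- incl a)" for x
  proof -
    have "inf (incl x) (incl a) = bot" using that by (simp add: incl_le_iff[symmetric] inf_shunt)
    then have "inf x a = bot" by (simp add: incl_inf[symmetric] incl_eq_bot_iff)
    then show ?thesis by (simp add: inf_shunt)
  qed
  then show "- incl a \<le> incl (- a)"
    unfolding less_eq_completion.rep_eq by (simp add: subset_iff incl_boolean_le_iff flip: incl_le_iff)
qed

text \<open>If \<open>y\<close> is disjoint from all of \<open>A\<close>, then \<open>- y\<close>
  bounds \<open>A\<close> and hence \<open>c\<close>. The least upper bound is described by its
  universal property because the Borel algebras to which this is applied have no \<open>Sup\<close>
  operation.\<close>

lemma incl_lub:
  fixes c :: "'a::boolean_algebra"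
  assumes "\<And>a. a \<in> A \<Longrightarrow> a \<le> c" and "\<And>t. (\<And>a. a \<in> A \<Longrightarrow> a \<le> t) \<Longrightarrow> c \<le> t"
  shows "incl c = Sup (incl ` A)"
proof (rule antisym)
  have A: "a \<in> members (Sup (incl ` A))" if "a \<in> A" for a
    unfolding incl_le_iff[symmetric] using that by (simp add: Sup_upper)
  have "inf c y = bot" if "y \<in> annih (members (Sup (incl ` A)))" for y
  proof -
    have "inf y a = bot" if "a \<in> A" for a
      using \<open>y \<in> _\<close> A[OF that] by (simp add: annih_def)
    then have "c \<le> - y" by (intro assms(2)) (simp add: inf_shunt[symmetric] inf.commute)
    then show ?thesis by (simp add: inf_shunt)
  qed
  then have "c \<in> annih (annih (members (Sup (incl ` A))))"
    by (simp add: annih_def)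
  then show "incl c \<le> Sup (incl ` A)" by (simp add: incl_le_iff annih_annih_members)
  show "Sup (incl ` A) \<le> incl c"
    using assms(1) by (intro Sup_least) (auto simp: incl_boolean_le_iff)
qed

section \<open>Generalised elements of a localic group\<close>

lemma frame_hom_comp: "frame_hom g \<Longrightarrow> frame_hom h \<Longrightarrow> frame_hom (h \<circ> g)"
  by (simp add: frame_hom_def image_comp)

lemma frame_hom_bot: "frame_hom h \<Longrightarrow> h bot = bot"
  unfolding frame_hom_def by (metis Sup_empty image_empty)

lemma frame_hom_sup: "frame_hom h \<Longrightarrow> h (sup a b) = sup (h a) (h b)"
proof -
  assume "frame_hom h"
  then have "h (Sup {a, b}) = Sup (h ` {a, b})" unfolding frame_hom_def by blast
  then show ?thesis by simp
qed

lemma frame_hom_id: "frame_hom id"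
  by (simp add: frame_hom_def)

lemma pairing_proj1: "frame_hom g \<Longrightarrow> frame_hom h \<Longrightarrow> pairing g h (proj1 a) = g a"
  using tensor_coproduct(2)[of g h] by (metis comp_apply)

lemma pairing_proj2: "frame_hom g \<Longrightarrow> frame_hom h \<Longrightarrow> pairing g h (proj2 a) = h a"
  using tensor_coproduct(3)[of g h] by (metis comp_apply)

lemma comp_pairing:
  assumes "frame_hom q" "frame_hom g" "frame_hom h"
  shows "q \<circ> pairing g h = pairing (q \<circ> g) (q \<circ> h)"
  by (intro tensor_coproduct(4) frame_hom_comp tensor_coproduct(1) assms)
     (simp_all add: fun_eq_iff pairing_proj1 pairing_proj2 assms)

lemma pairing_proj_id: "pairing proj1 proj2 = id"
  by (rule tensor_coproduct(4)[symmetric])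
     (simp_all add: frame_hom_proj1 frame_hom_proj2 frame_hom_id)

context localic_group
begin

text \<open>A frame homomorphism out of O(G) is a generalised point of G over the locale whose frame
  is the target. This is the group operation on such points.\<close>

definition times :: "('g \<Rightarrow> 'c::frame) \<Rightarrow> ('g \<Rightarrow> 'c) \<Rightarrow> 'g \<Rightarrow> 'c" where
  "times u v = pairing u v \<circ> m"

lemma frame_hom_times: "frame_hom u \<Longrightarrow> frame_hom v \<Longrightarrow> frame_hom (times u v)"
  unfolding times_def by (intro frame_hom_comp mult_hom tensor_coproduct(1))

lemma comp_times:
  "frame_hom q \<Longrightarrow> frame_hom u \<Longrightarrow> frame_hom v \<Longrightarrow> q \<circ> times u v = times (q \<circ> u) (q \<circ> v)"
  unfolding times_def by (simp add: comp_assoc[symmetric] comp_pairing)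

lemma frame_hom_inverse: "frame_hom u \<Longrightarrow> frame_hom (u \<circ> i)"
  by (intro frame_hom_comp inv_hom)

text \<open>The axiom \<open>assoc\<close> speaks of the universal triple of projections; composing
  with \<open>?q\<close>, which classifies the triple \<open>u\<close>, \<open>v\<close>,
  \<open>w\<close>, transports it to all points.\<close>

lemma times_assoc:
  assumes u: "frame_hom u" and v: "frame_hom v" and w: "frame_hom w"
  shows "times (times u v) w = times u (times v w)"
proof -
  let ?q = "pairing u (pairing v w)"
  note homs = u v w frame_hom_proj1 frame_hom_proj2 frame_hom_comp frame_hom_times
  have q: "frame_hom ?q" by (intro homs tensor_coproduct(1))
  have c: "?q \<circ> proj1 = u" "?q \<circ> (proj2 \<circ> proj1) = v" "?q \<circ> (proj2 \<circ> proj2) = w"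
    by (simp_all add: fun_eq_iff pairing_proj1 pairing_proj2 u v w tensor_coproduct(1))
  have "times (times proj1 (proj2 \<circ> proj1)) (proj2 \<circ> proj2) =
      (times proj1 (times (proj2 \<circ> proj1) (proj2 \<circ> proj2)) :: 'g \<Rightarrow> ('g, ('g, 'g) tensor) tensor)"
    unfolding times_def by (rule assoc)
  then have "?q \<circ> times (times proj1 (proj2 \<circ> proj1)) (proj2 \<circ> proj2) =
      ?q \<circ> times proj1 (times (proj2 \<circ> proj1) (proj2 \<circ> proj2))" by simp
  then show ?thesis by (simp only: comp_times[OF q] homs c)
qed

lemma
  assumes u: "frame_hom u"
  shows times_unit_left: "times (init \<circ> e) u = u"
    and times_unit_right: "times u (init \<circ> e) = u"
    and times_inverse_left: "times (u \<circ> i) u = init \<circ> e"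
    and times_inverse_right: "times u (u \<circ> i) = init \<circ> e"
proof -
  have ie: "frame_hom (init \<circ> e :: 'g \<Rightarrow> 'g)" by (intro frame_hom_comp unit_hom frame_hom_init)
  have "u \<circ> init = init" by (intro frame_hom_init_unique frame_hom_comp frame_hom_init u)
  then have [simp]: "u \<circ> (init \<circ> e) = init \<circ> e" by (simp add: comp_assoc[symmetric])
  show "times (init \<circ> e) u = u"
    using comp_times[OF u ie frame_hom_id] by (simp add: times_def left_unit)
  show "times u (init \<circ> e) = u"
    using comp_times[OF u frame_hom_id ie] by (simp add: times_def right_unit)
  show "times (u \<circ> i) u = init \<circ> e"
    using comp_times[OF u inv_hom frame_hom_id] by (simp add: times_def left_inv)
  show "times u (u \<circ> i) = init \<circ> e"
    using comp_times[OF u frame_hom_id inv_hom] by (simp add: times_def right_inv)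
qed

text \<open>The first two equations come from associativity, the last two from these by cancelling
  \<open>?t\<close> and \<open>?s\<close>, which avoids a rule for inverting a product. The last two
  make x -> x^-1 y and x -> y x^-1 mutually inverse for fixed y.\<close>

lemma times_cancel:
  assumes u: "frame_hom u" and v: "frame_hom v"
  shows "times u (times (u \<circ> i) v) = v" "times (times v (u \<circ> i)) u = v"
    "times v (times (u \<circ> i) v \<circ> i) = u" "times (times v (u \<circ> i) \<circ> i) v = u"
proof -
  note homs = u v frame_hom_times frame_hom_inverse
  show 1: "times u (times (u \<circ> i) v) = v"
    using times_assoc[OF u frame_hom_inverse[OF u] v] u v
    by (simp add: times_inverse_right times_unit_left)
  show 2: "times (times v (u \<circ> i)) u = v"
    using times_assoc[OF v frame_hom_inverse[OF u] u] u v
    by (simp add: times_inverse_left times_unit_right)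
  let ?t = "times (u \<circ> i) v" and ?s = "times v (u \<circ> i)"
  have "times (times u ?t) (?t \<circ> i) = times u (times ?t (?t \<circ> i))"
    by (intro times_assoc homs)
  then show "times v (?t \<circ> i) = u"
    by (simp only: 1 times_inverse_right homs times_unit_right)
  have "times (?s \<circ> i) (times ?s u) = times (times (?s \<circ> i) ?s) u"
    by (intro times_assoc[symmetric] homs)
  then show "times (?s \<circ> i) v = u"
    by (simp only: 2 times_inverse_left homs times_unit_left)
qed

end


section \<open>Complete homomorphisms on Borel sets\<close>

text \<open>The counterpart of \<open>borel_map\<close> for complete Boolean targets, where
  \<open>join\<close> goes to a supremum. Points with values in a completion are of this
  kind.\<close>

definition borel_hom :: "(('a::frame, 'k) borel \<Rightarrow> 'c::{boolean_algebra, frame}) \<Rightarrow> bool" where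
  "borel_hom p \<longleftrightarrow>
     (\<forall>x y. p (inf x y) = inf (p x) (p y)) \<and> (\<forall>x. p (- x) = - p x) \<and>
     (\<forall>s. p (join s) = (SUP k. p (s k)))"

lemma borel_hom_simps:
  assumes "borel_hom p"
  shows "p (inf x y) = inf (p x) (p y)" "p (- x) = - p x" "p (join s) = (SUP k. p (s k))"
    and "p bot = bot" "p top = top"
proof -
  show 1: "p (inf x y) = inf (p x) (p y)" "p (- x) = - p x" "p (join s) = (SUP k. p (s k))"
    for x y s using assms by (simp_all add: borel_hom_def)
  show 2: "p bot = bot" using 1(1)[of bot "- bot"] 1(2)[of bot] by simp
  show "p top = top" using 1(2)[of bot] 2 by simp
qed

lemma borel_hom_eqI:
  assumes "borel_hom p" "borel_hom q" "\<And>a. p (gen a) = q (gen a)"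
  shows "p x = q x"
  by (induct x rule: borel_induct) (use assms in \<open>simp_all add: borel_hom_simps\<close>)

lemma borel_hom_mono: "borel_hom p \<Longrightarrow> x \<le> y \<Longrightarrow> p x \<le> p y"
  by (metis borel_hom_simps(1) inf.absorb_iff1)

lemma borel_hom_comp_borel_map: "borel_hom p \<Longrightarrow> borel_map q \<Longrightarrow> borel_hom (p \<circ> q)"
  by (simp add: borel_hom_def borel_map_def)

lemma frame_hom_uminus:
  fixes h :: "'a::{boolean_algebra, frame} \<Rightarrow> 'b::{boolean_algebra, frame}"
  assumes "frame_hom h"
  shows "h (- a) = - h a"
proof (rule compl_unique[symmetric])
  have h: "h (inf a b) = inf (h a) (h b)" "h top = top" for a b
    using assms by (simp_all add: frame_hom_def)
  show "inf (h a) (h (- a)) = bot" using h(1)[of a "- a"] frame_hom_bot[OF assms] by simp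
  show "sup (h a) (h (- a)) = top" using frame_hom_sup[OF assms, of a "- a"] h by simp
qed

lemma frame_hom_comp_borel_hom:
  assumes "borel_hom p" "frame_hom h"
  shows "borel_hom (h \<circ> p)"
  using assms unfolding borel_hom_def
  by (simp add: frame_hom_uminus image_image) (simp add: frame_hom_def image_image)

lemma borel_hom_extension:
  fixes h :: "'a::frame \<Rightarrow> 'c::{boolean_algebra, frame}"
  assumes "frame_hom h"
  obtains p :: "('a, 'k) borel \<Rightarrow> 'c" where "borel_hom p" "\<And>a. p (gen a) = h a"
  using borel_free[of h] assms unfolding frame_hom_def borel_hom_def by blast

text \<open>\<open>p\<close> respects joins indexed by \<open>'k\<close>. The two injections turn
  the join of the rectangles in \<open>D\<close> into an iterated \<open>join\<close>, padded with
  \<open>bot\<close> at indices that name no rectangle of \<open>D\<close>.\<close>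

lemma borel_hom_gen_tensor:
  fixes p :: "(('a::frame, 'b::frame) tensor, 'k) borel \<Rightarrow> 'c::{boolean_algebra, frame}"
    and \<iota> :: "'a \<Rightarrow> 'k" and \<kappa> :: "'b \<Rightarrow> 'k"
  assumes p: "borel_hom p" and inj: "inj \<iota>" "inj \<kappa>"
  shows "p (gen D) = (SUP (a, b)\<in>rects D. p (gen (rect a b)))"
proof (rule antisym)
  let ?s = "\<lambda>k. join (\<lambda>l. if k \<in> range \<iota> \<and> l \<in> range \<kappa> \<and> (inv \<iota> k, inv \<kappa> l) \<in> rects D
      then gen (rect (inv \<iota> k) (inv \<kappa> l)) else bot :: (('a, 'b) tensor, 'k) borel)"
  have "gen (rect a b) \<le> join ?s" if "(a, b) \<in> rects D" for a b
    by (rule order_trans[OF _ join_upper[of _ "\<iota> a"]],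
        rule order_trans[OF _ join_upper[of _ "\<kappa> b"]]) (use that inj in simp)
  then have "gen (SUP (a, b)\<in>rects D. rect a b) \<le> join ?s"
    by (intro gen_Sup_least) auto
  then have "p (gen D) \<le> p (join ?s)"
    using tensor_eq_Sup_rect[of D] by (simp add: borel_hom_mono[OF p])
  also have "\<dots> \<le> (SUP (a, b)\<in>rects D. p (gen (rect a b)))"
    unfolding borel_hom_simps(3)[OF p]
    by (intro SUP_least) (auto simp: borel_hom_simps[OF p] intro: SUP_upper2)
  finally show "p (gen D) \<le> (SUP (a, b)\<in>rects D. p (gen (rect a b)))" .
  show "(SUP (a, b)\<in>rects D. p (gen (rect a b))) \<le> p (gen D)"
    by (auto intro!: SUP_least borel_hom_mono[OF p] gen_mono simp: rect_le_iff)
qed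

lemma gen_le_gen_iff: "gen a \<le> (gen b :: ('a::frame, 'k) borel) \<longleftrightarrow> a \<le> b"
  by (simp add: inf.absorb_iff1 gen_inject flip: gen_inf)

lemma borel_hom_incl: "borel_hom (incl :: ('a::frame, 'k) borel \<Rightarrow> _)"
  unfolding borel_hom_def
proof (intro conjI allI)
  fix s :: "'k \<Rightarrow> ('a, 'k) borel"
  show "incl (join s) = (SUP k. incl (s k))"
    using incl_lub[of "range s" "join s"] by (auto simp: image_image intro: join_upper join_least)
qed (simp_all add: incl_inf incl_uminus)

text \<open>\<open>gen (Sup A)\<close> is a least upper bound in the Borel algebra for
  \<open>A\<close> of any size, and \<open>incl\<close> keeps existing least upper bounds.\<close>

lemma frame_hom_incl_gen: "frame_hom (incl \<circ> (gen :: 'a::frame \<Rightarrow> ('a, 'k) borel))"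
  unfolding frame_hom_def comp_def
proof (intro conjI allI)
  show "incl (gen top :: ('a, 'k) borel) = top" by (simp add: gen_top incl_eq_top_iff dense_def)
  show "incl (gen (inf a b) :: ('a, 'k) borel) = inf (incl (gen a)) (incl (gen b))" for a b
    by (simp add: gen_inf incl_inf)
  show "incl (gen (Sup A) :: ('a, 'k) borel) = (SUP a\<in>A. incl (gen a))" for A
    using incl_lub[of "gen ` A" "gen (Sup A) :: ('a, 'k) borel"]
    by (auto simp: image_image intro: gen_mono gen_Sup_least Sup_upper)
qed

section \<open>The Baire property\<close>

text \<open>The boundary of an open set is nowhere dense. Consequently a point in all dense opens
  lies either in \<open>u\<close> or in its pseudocomplement.\<close>

lemma dense_sup_pseudocomplement: "dense (sup u (Sup {y. inf u y = bot}))" for u :: "'a::frame"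
  unfolding dense_def
proof (intro allI impI)
  fix y assume y: "inf (sup u (Sup {y. inf u y = bot})) y = bot"
  have "inf u y \<le> inf (sup u (Sup {y. inf u y = bot})) y" by (intro inf_mono) auto
  then have "inf u y = bot" using y by (simp add: bot_unique)
  then have "y \<le> sup u (Sup {y. inf u y = bot})" by (intro le_supI2 Sup_upper) simp
  then show "y = bot" using y by (simp add: inf.absorb2)
qed

text \<open>Induction on \<open>x\<close>. Complements become pseudocomplements, since a point in
  all dense opens avoids boundaries; meets and joins are taken among the opens. The open set is
  chosen before the point and serves all \<open>p\<close> with values in \<open>'c\<close> at
  once.\<close>

lemma baire_property:
  fixes x :: "('a::frame, 'k) borel"
  obtains u where "\<And>p :: ('a, 'k) borel \<Rightarrow> 'c::{boolean_algebra, frame}.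
    borel_hom p \<Longrightarrow> frame_hom (p \<circ> gen) \<Longrightarrow> (\<And>d. dense d \<Longrightarrow> p (gen d) = top) \<Longrightarrow> p x = p (gen u)"
proof -
  define H where "H = {p :: ('a, 'k) borel \<Rightarrow> 'c.
    borel_hom p \<and> frame_hom (p \<circ> gen) \<and> (\<forall>d. dense d \<longrightarrow> p (gen d) = top)}"
  have H: "borel_hom p" "frame_hom (p \<circ> gen)" "dense d \<Longrightarrow> p (gen d) = top" if "p \<in> H" for p d
    using that by (simp_all add: H_def)
  have "\<exists>u. \<forall>p\<in>H. p x = p (gen u)"
  proof (induct x rule: borel_induct)
    case (gen a)
    show ?case by blast
  next
    case (neg x)
    then obtain u where u: "\<forall>p\<in>H. p x = p (gen u)" ..
    let ?v = "Sup {y. inf u y = bot}"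
    have "p (- x) = p (gen ?v)" if p: "p \<in> H" for p
    proof -
      have hom: "borel_hom p" and fr: "frame_hom (p \<circ> gen)" using H[OF p] by blast+
      have "inf u ?v \<le> bot" unfolding inf_Sup_distrib by (intro Sup_least) auto
      then have "inf u ?v = bot" by (rule bot.extremum_uniqueI)
      then have "inf (p (gen u)) (p (gen ?v)) = bot"
        using borel_hom_simps[OF hom] by (metis gen_bot gen_inf)
      moreover have "sup (p (gen u)) (p (gen ?v)) = top"
        using frame_hom_sup[OF fr, of u ?v] H(3)[OF p dense_sup_pseudocomplement[of u]] by simp
      ultimately have "- p (gen u) = p (gen ?v)" by (rule compl_unique)
      moreover have "p x = p (gen u)" using u p by blast
      ultimately show ?thesis using borel_hom_simps(2)[OF hom] by simp
    qed
    then show ?case by blast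
  next
    case (conj x y)
    then obtain u v where u: "\<forall>p\<in>H. p x = p (gen u)" and v: "\<forall>p\<in>H. p y = p (gen v)" by blast
    have "p (inf x y) = p (gen (inf u v))" if p: "p \<in> H" for p
    proof -
      have "p x = p (gen u)" "p y = p (gen v)" using u v p by blast+
      then show ?thesis using H(1)[OF p] by (simp add: borel_hom_simps(1) gen_inf)
    qed
    then show ?case by blast
  next
    case (join s)
    then obtain u where u: "\<And>k. \<forall>p\<in>H. p (s k) = p (gen (u k))" by metis
    have "p (join s) = p (gen (SUP k. u k))" if p: "p \<in> H" for p
    proof -
      have "(p \<circ> gen) (SUP k. u k) = (SUP k. (p \<circ> gen) (u k))"
        using H(2)[OF p] unfolding frame_hom_def by (simp add: image_image)
      moreover have "p (s k) = p (gen (u k))" for k using u p by blast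
      ultimately show ?thesis using H(1)[OF p] by (simp add: borel_hom_simps(3))
    qed
    then show ?case by blast
  qed
  then show ?thesis using that unfolding H_def by blast
qed

section \<open>Density in products\<close>

lemma inf_rect: "inf (rect a b) (rect c d) = rect (inf a c) (inf b d)"
proof -
  have "proj1 (inf a c) = (inf (proj1 a) (proj1 c) :: ('a, 'b) tensor)"
    "proj2 (inf b d) = (inf (proj2 b) (proj2 d) :: ('a, 'b) tensor)"
    using frame_hom_proj1 frame_hom_proj2 unfolding frame_hom_def by blast+
  then show ?thesis by (simp add: rect_eq_inf inf_aci)
qed

text \<open>\<open>rect bot bot\<close> is the least element, and its members are exactly the
  rectangles with an empty side.\<close>

lemma rect_eq_bot_iff: "rect a b = bot \<longleftrightarrow> a = bot \<or> b = bot"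
proof -
  have "rect bot bot \<le> (bot :: ('a, 'b) tensor)"
    unfolding rect_le_iff by (intro C_ideal_bot C_ideal_rects)
  then have "rect bot bot = (bot :: ('a, 'b) tensor)" by (rule bot.extremum_uniqueI)
  then have "rect a b = bot \<longleftrightarrow> rect a b \<le> rect bot bot" by (simp add: bot_unique)
  also have "\<dots> \<longleftrightarrow> a = bot \<or> b = bot" by (auto simp: rect_le_iff rects_rect bot_unique)
  finally show ?thesis .
qed

text \<open>Rectangles generate, so density can be tested on them: one that misses
  \<open>proj1 d\<close> has an empty side.\<close>

lemma dense_proj1:
  assumes "dense d"
  shows "dense (proj1 d)"
  unfolding dense_def
proof (intro allI impI)
  fix D :: "('a, 'b) tensor"
  assume D: "inf (proj1 d) D = bot"
  have "rect a b = bot" if "(a, b) \<in> rects D" for a b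
  proof -
    have "inf (proj1 d) (rect a b) \<le> inf (proj1 d) D"
      using that by (intro inf_mono) (simp_all add: rect_le_iff)
    then have "rect (inf d a) b = bot" unfolding D bot_unique by (simp add: proj1_def inf_rect)
    then show ?thesis using assms by (auto simp: rect_eq_bot_iff dense_def)
  qed
  then have "(SUP (a, b)\<in>rects D. rect a b) \<le> bot" by (intro SUP_least) auto
  then show "D = bot" using tensor_eq_Sup_rect[of D] by (simp add: bot_unique)
qed

lemma dense_frame_iso:
  assumes h: "frame_hom h" "frame_hom k" "h \<circ> k = id" "k \<circ> h = id" and d: "dense d"
  shows "dense (h d)"
  unfolding dense_def
proof (intro allI impI)
  fix y assume "inf (h d) y = bot"
  moreover have "k (inf (h d) y) = inf (k (h d)) (k y)" using h(2) by (simp add: frame_hom_def)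
  ultimately have "inf d (k y) = bot"
    using h by (simp add: frame_hom_bot fun_eq_iff)
  then have "k y = bot" using d by (simp add: dense_def)
  then have "h (k y) = bot" using h by (simp add: frame_hom_bot)
  then show "y = bot" using h(3) by (simp add: fun_eq_iff)
qed

context localic_group
begin

text \<open>
  Pointwise: if d is dense open and U is nonempty open, then U d is the whole group.
\<close>

lemma dense_times:
  fixes q :: "'g \<Rightarrow> 'b::frame"
  assumes q: "frame_hom q" and d: "dense d"
  shows "dense (times (proj1 \<circ> i) (proj2 \<circ> q) d)"
proof -
  let ?p = "proj1 :: 'g \<Rightarrow> ('g, 'b) tensor" and ?q = "proj2 \<circ> q :: 'g \<Rightarrow> ('g, 'b) tensor"
  \<comment> \<open>\<open>?h\<close> is the inverse image along the shear (x, t) -> (x^-1 q(t), t),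
    and \<open>?k\<close> the one along its inverse (x, t) -> (q(t) x^-1, t).\<close>
  let ?h = "pairing (times (?p \<circ> i) ?q) proj2" and ?k = "pairing (times ?q (?p \<circ> i)) proj2"
  note homs = frame_hom_proj1 frame_hom_proj2 frame_hom_times frame_hom_inverse frame_hom_comp
    tensor_coproduct(1) q
  have hom: "frame_hom ?h" "frame_hom ?k" by (intro homs)+
  have hp: "?h \<circ> ?p = times (?p \<circ> i) ?q" "?h \<circ> ?q = ?q" "?h \<circ> proj2 = proj2"
    and kp: "?k \<circ> ?p = times ?q (?p \<circ> i)" "?k \<circ> ?q = ?q" "?k \<circ> proj2 = proj2"
    by (simp_all add: fun_eq_iff pairing_proj1 pairing_proj2 homs)
  have "?h \<circ> times ?q (?p \<circ> i) = times ?q (times (?p \<circ> i) ?q \<circ> i)"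
    by (simp only: comp_times hom homs comp_assoc[symmetric] hp)
  also have "\<dots> = ?p" by (intro times_cancel homs)
  finally have "?h \<circ> ?k = id"
    by (simp add: comp_pairing homs hp pairing_proj_id)
  have "?k \<circ> times (?p \<circ> i) ?q = times (times ?q (?p \<circ> i) \<circ> i) ?q"
    by (simp only: comp_times hom homs comp_assoc[symmetric] kp)
  also have "\<dots> = ?p" by (intro times_cancel homs)
  finally have "?k \<circ> ?h = id"
    by (simp add: comp_pairing homs kp pairing_proj_id)
  have "dense (?h (?p d))"
    by (rule dense_frame_iso[OF hom \<open>?h \<circ> ?k = id\<close> \<open>?k \<circ> ?h = id\<close> dense_proj1[OF d]])
  then show ?thesis using hp(1) by (simp add: fun_eq_iff)
qed

section \<open>Descent of openness along the second projection\<close>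

lemma incl_rect_le_proj2:
  fixes z :: "'b::{boolean_algebra, frame}"
  assumes le: "incl (rect a c) \<le> incl (proj2 z)" and "a \<noteq> bot"
  shows "c \<le> z"
proof -
  \<comment> \<open>\<open>z\<close> has a complement and \<open>incl\<close> reflects disjointness:
    the rectangle over \<open>- z\<close> misses \<open>proj2 z\<close>, hence also
    \<open>rect a c\<close>.\<close>
  have "inf (proj2 z) (rect top (- z)) = bot" by (simp add: proj2_def inf_rect rect_eq_bot_iff)
  then have "rect (inf a top) (inf c (- z)) = bot"
    using le unfolding incl_le_incl_iff inf_rect[symmetric] by blast
  then show ?thesis using \<open>a \<noteq> bot\<close> by (simp add: rect_eq_bot_iff inf_shunt)
qed

text \<open>By \<open>eq\<close>, at the generic pair (s, t) the point t lies in the Borel set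
  \<open>x\<close> exactly when (s, s^-1 t) lies in the open set \<open>W\<close>. A condition on t
  alone thus agrees with an open condition on the pair, and the latter has an open image under the
  second projection.\<close>

lemma open_of_generic_open:
  fixes x :: "('g, 'k) borel" and W :: "('g, 'g) tensor"
  assumes eq: "incl (proj2 (incl x) :: ('g, ('g, 'k) borel completion) tensor) =
    incl (pairing proj1 (times (proj1 \<circ> i) (proj2 \<circ> (incl \<circ> gen))) W)"
  shows "\<exists>U. x = gen U"
proof -
  let ?b = "incl \<circ> gen :: 'g \<Rightarrow> ('g, 'k) borel completion"
  let ?p = "proj1 :: 'g \<Rightarrow> ('g, ('g, 'k) borel completion) tensor"
  let ?s = "pairing ?p (proj2 \<circ> ?b)"
  \<comment> \<open>The witness U is the image of W' under the second projection.\<close>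
  define W' :: "('g, 'g) tensor" where "W' = pairing proj1 (times (proj1 \<circ> i) proj2) W"
  note homs = frame_hom_proj1 frame_hom_proj2 frame_hom_times frame_hom_inverse frame_hom_comp
    tensor_coproduct(1) frame_hom_incl_gen
  have s: "frame_hom ?s" by (intro homs)
  have sp: "?s \<circ> proj1 = ?p" "?s \<circ> proj2 = proj2 \<circ> ?b"
    by (intro tensor_coproduct homs)+
  then have "?s \<circ> (proj1 \<circ> i) = ?p \<circ> i" by (simp add: comp_assoc[symmetric])
  with sp have "?s \<circ> pairing proj1 (times (proj1 \<circ> i) proj2) =
      pairing ?p (times (?p \<circ> i) (proj2 \<circ> ?b))"
    by (simp only: comp_pairing comp_times s homs)
  \<comment> \<open>\<open>W'\<close> lives over G x G, and \<open>?s\<close> extends its second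
    factor along \<open>?b\<close>. Hence the right-hand side of \<open>eq\<close> is a join of
    rectangles \<open>rect a (?b u)\<close> with \<open>u\<close> open.\<close>
  then have "pairing ?p (times (?p \<circ> i) (proj2 \<circ> ?b)) W = ?s W'"
    by (simp add: W'_def fun_eq_iff)
  also have "\<dots> = (SUP (a, u)\<in>rects W'. rect a (?b u))"
    by (simp add: pairing_def rect_eq_inf)
  finally have eq': "incl (proj2 (incl x)) = incl (SUP (a, u)\<in>rects W'. rect a (?b u))"
    using eq by simp
  \<comment> \<open>Every C-ideal contains all pairs \<open>(bot, u)\<close>, so empty first sides
    have to be excluded.\<close>
  define U where "U = Sup {u. \<exists>a. a \<noteq> bot \<and> (a, u) \<in> rects W'}"
  have "gen u \<le> x" if "a \<noteq> bot" "(a, u) \<in> rects W'" for a u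
  proof -
    have "rect a (?b u) \<le> (SUP (a, u)\<in>rects W'. rect a (?b u))"
      using that(2) by (auto intro: SUP_upper2)
    then have "incl (rect a (?b u)) \<le> incl (proj2 (incl x))"
      unfolding eq' by (rule monoD[OF frame_hom_mono[OF frame_hom_incl]])
    from incl_rect_le_proj2[OF this that(1)] show ?thesis by (simp add: incl_boolean_le_iff)
  qed
  then have "gen U \<le> x" unfolding U_def by (intro gen_Sup_least) auto
  moreover have "x \<le> gen U"
  proof -
    have "rect a (?b u) \<le> proj2 (?b U)" if "(a, u) \<in> rects W'" for a u
    proof (cases "a = bot")
      case True
      then have "rect a (?b u) = bot" by (simp add: rect_eq_bot_iff)
      then show ?thesis by simp
    next
      case False
      then have "u \<le> U" using that by (auto simp: U_def intro: Sup_upper)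
      then show ?thesis
        by (simp add: proj2_def rect_le_iff rects_rect incl_boolean_le_iff gen_mono)
    qed
    then have "(SUP (a, u)\<in>rects W'. rect a (?b u)) \<le> proj2 (?b U)"
      by (intro SUP_least) auto
    then have "incl (rect top (incl x)) \<le> incl (proj2 (?b U) :: ('g, ('g, 'k) borel completion) tensor)"
      using monoD[OF frame_hom_mono[OF frame_hom_incl]] unfolding proj2_def[symmetric] eq' by blast
    \<comment> \<open>The identity is a point of G, so O(G) is nontrivial and \<open>top\<close> can
      serve as the first side of the rectangle.\<close>
    moreover have "(top :: 'g) \<noteq> bot"
      using unit_hom frame_hom_bot[OF unit_hom] by (auto simp: frame_hom_def)
    ultimately have "incl x \<le> ?b U" by (rule incl_rect_le_proj2)
    then show ?thesis by (simp add: incl_boolean_le_iff)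
  qed
  ultimately show ?thesis by (auto intro: antisym)
qed

end

section \<open>Products of Borel maps, and Borel maps with open preimages of opens\<close>

lemma borel_prod:
  fixes f :: "('c::frame, 'k) borel \<Rightarrow> ('a::frame, 'k) borel"
    and g :: "('d::frame, 'k) borel \<Rightarrow> ('b::frame, 'k) borel"
  assumes "borel_map f" "borel_map g" "\<exists>\<iota> :: 'c \<Rightarrow> 'k. inj \<iota>" "\<exists>\<kappa> :: 'd \<Rightarrow> 'k. inj \<kappa>"
  shows borel_map_borel_prod: "borel_map (borel_prod f g)"
    and borel_prod_gen_rect:
      "borel_prod f g (gen (rect c d)) = inf (borel_of proj1 (f (gen c))) (borel_of proj2 (g (gen d)))"
proof -
  have P: "borel_map (borel_prod f g) \<and>
     borel_prod f g \<circ> borel_of proj1 = borel_of proj1 \<circ> f \<and>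
     borel_prod f g \<circ> borel_of proj2 = borel_of proj2 \<circ> g"
    unfolding borel_prod_def by (rule theI'[OF borel_prod_ex1[OF assms]])
  then show B: "borel_map (borel_prod f g)" by blast
  have "borel_prod f g (gen (proj1 c)) = borel_of proj1 (f (gen c))"
    "borel_prod f g (gen (proj2 d)) = borel_of proj2 (g (gen d))"
    using P by (auto simp: fun_eq_iff frame_hom_proj1 frame_hom_proj2 simp flip: borel_of_gen)
  then show "borel_prod f g (gen (rect c d)) = inf (borel_of proj1 (f (gen c))) (borel_of proj2 (g (gen d)))"
    by (simp add: rect_eq_inf gen_inf borel_map_simps(1)[OF B])
qed

text \<open>By injectivity of \<open>gen\<close> the open preimages are unique, so they inherit
  meets and joins from \<open>f\<close>. For joins of arbitrary families,
  \<open>borel_map_gen_Sup\<close> uses the injection into \<open>'k\<close>.\<close>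

lemma frame_hom_of_open_preimages:
  fixes f :: "('a::frame, 'k) borel \<Rightarrow> ('b::frame, 'k) borel"
  assumes f: "borel_map f" and "\<exists>\<iota> :: 'a \<Rightarrow> 'k. inj \<iota>" and op: "\<And>V. \<exists>U. f (gen V) = gen U"
  shows "\<exists>h. frame_hom h \<and> f = borel_of h"
proof -
  obtain h where h: "f (gen V) = gen (h V)" for V using op by metis
  have "frame_hom h"
    unfolding frame_hom_def
  proof (intro conjI allI)
    show "h top = top" using h[of top] borel_map_simps(5)[OF f] by (metis gen_inject gen_top)
    show inf: "h (inf a b) = inf (h a) (h b)" for a b
      using h borel_map_simps(1)[OF f] by (metis gen_inject gen_inf)
    then have mono: "h a \<le> h b" if "a \<le> b" for a b using that by (metis inf.absorb_iff1)
    fix A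
    obtain \<iota> :: "'a \<Rightarrow> 'k" where \<iota>: "inj \<iota>" using assms(2) ..
    have "f (gen (Sup A)) \<le> gen (Sup (h ` A))"
      by (rule borel_map_gen_Sup[OF f \<iota>]) (auto simp: h intro: gen_mono Sup_upper)
    then have "h (Sup A) \<le> Sup (h ` A)" by (simp add: h gen_le_gen_iff)
    moreover have "Sup (h ` A) \<le> h (Sup A)" by (auto intro!: Sup_least mono Sup_upper)
    ultimately show "h (Sup A) = Sup (h ` A)" by (rule antisym)
  qed
  moreover from this have "f = borel_of h"
    by (intro borel_map_eqI[OF f borel_map_borel_of]) (simp_all add: h borel_of_gen)
  ultimately show ?thesis by blast
qed

theorem theorem4p2:
  fixes mG :: "'g::frame \<Rightarrow> ('g, 'g) tensor" and eG :: "'g \<Rightarrow> bool" and iG :: "'g \<Rightarrow> 'g"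
    and mH :: "'h::frame \<Rightarrow> ('h, 'h) tensor" and eH :: "'h \<Rightarrow> bool" and iH :: "'h \<Rightarrow> 'h"
    and f :: "('h, 'k) borel \<Rightarrow> ('g, 'k) borel"
  assumes "localic_group mG eG iG"
    and "localic_group mH eH iH"
    and "\<exists>\<iota> :: 'h \<Rightarrow> 'k. inj \<iota>"
    and "borel_group_hom mG eG iG mH eH iH f"
  shows "(\<forall>V. \<exists>U. f (gen V) = gen U) \<and> (\<exists>h. frame_hom h \<and> f = borel_of h)"
proof -
  interpret G: localic_group mG eG iG by (rule assms(1))
  interpret H: localic_group mH eH iH by (rule assms(2))
  obtain \<iota> :: "'h \<Rightarrow> 'k" where \<iota>: "inj \<iota>" using assms(3) ..
  have f: "borel_map f" and fm: "borel_of mG \<circ> f = borel_prod f f \<circ> borel_of mH"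
    using assms(4) by (simp_all add: borel_group_hom_def)
  \<comment> \<open>\<open>?p\<close> is the point x and \<open>?q\<close> the point y, still with
    values in the coproduct; \<open>r\<close> is x^-1 y.\<close>
  let ?p = "proj1 :: 'g \<Rightarrow> ('g, ('g, 'k) borel completion) tensor"
  let ?q = "proj2 \<circ> (incl \<circ> gen :: 'g \<Rightarrow> ('g, 'k) borel completion) :: 'g \<Rightarrow> ('g, ('g, 'k) borel completion) tensor"
  define r where "r = G.times (?p \<circ> iG) ?q"
  \<comment> \<open>The pair (x, x^-1 y) as a point of G x G over the completion; \<open>P\<close>
    extends it to Borel sets.\<close>
  define \<Phi> where "\<Phi> = incl \<circ> pairing ?p r"
  note homs = frame_hom_proj1 frame_hom_proj2 G.frame_hom_times G.frame_hom_inverse frame_hom_comp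
    tensor_coproduct(1) frame_hom_incl_gen frame_hom_incl
  have r: "frame_hom r" unfolding r_def by (intro homs)
  have \<Phi>: "frame_hom \<Phi>" unfolding \<Phi>_def by (intro homs r)
  obtain P :: "(('g, 'g) tensor, 'k) borel \<Rightarrow> ('g, ('g, 'k) borel completion) tensor completion"
    where P: "borel_hom P" and Pgen: "\<And>D. P (gen D) = \<Phi> D"
    using borel_hom_extension[OF \<Phi>] by blast
  \<comment> \<open>x (x\<open>\<^sup>-\<^sup>1\<close>y) = y\<close>
  have "G.times ?p r = ?q" unfolding r_def by (intro G.times_cancel homs)
  then have m: "pairing ?p r (mG V) = ?q V" for V
    by (simp add: G.times_def fun_eq_iff)
  \<comment> \<open>The product of x and x^-1 y is y. The inner \<open>incl\<close> completes the
    Borel algebra, the outer one the coproduct.\<close>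
  have y: "P (borel_of mG x) = incl (proj2 (incl x))" for x
  proof -
    have "(P \<circ> borel_of mG) x = ((incl \<circ> proj2) \<circ> incl) x"
    proof (rule borel_hom_eqI)
      show "borel_hom (P \<circ> borel_of mG)"
        by (intro borel_hom_comp_borel_map P borel_map_borel_of G.mult_hom)
      show "borel_hom ((incl \<circ> proj2) \<circ> incl)"
        by (intro frame_hom_comp_borel_hom borel_hom_incl homs)
    qed (simp add: borel_of_gen G.mult_hom Pgen \<Phi>_def m)
    then show ?thesis by simp
  qed
  \<comment> \<open>\<open>h\<close> is a mere choice function: \<open>h V\<close> is an open set
    that agrees with \<open>f (gen V)\<close> at all points in every dense open, so it serves x and
    x^-1 y alike.\<close>
  obtain h where h: "p (f (gen V)) = p (gen (h V))"
    if "borel_hom p" "frame_hom (p \<circ> gen)" "\<And>d. dense d \<Longrightarrow> p (gen d) = top"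
    for V and p :: "('g, 'k) borel \<Rightarrow> ('g, ('g, 'k) borel completion) tensor completion"
  proof -
    have "\<exists>u. \<forall>p :: ('g, 'k) borel \<Rightarrow> ('g, ('g, 'k) borel completion) tensor completion.
        borel_hom p \<longrightarrow> frame_hom (p \<circ> gen) \<longrightarrow> (\<forall>d. dense d \<longrightarrow> p (gen d) = top) \<longrightarrow>
        p (f (gen V)) = p (gen u)" for V
      by (rule baire_property[of "f (gen V)"]) blast
    then show ?thesis using that by metis
  qed
  have P1: "P (borel_of proj1 (f (gen V))) = \<Phi> (proj1 (h V))"
    and P2: "P (borel_of proj2 (f (gen V))) = \<Phi> (proj2 (h V))" for V
  proof -
    \<comment> \<open>The point x, which lies in every dense open by
      \<open>dense_proj1\<close>.\<close>
    have "(P \<circ> borel_of proj1) (f (gen V)) = (P \<circ> borel_of proj1) (gen (h V))"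
    proof (rule h)
      show "borel_hom (P \<circ> borel_of proj1)"
        by (intro borel_hom_comp_borel_map P borel_map_borel_of homs)
      have g: "(P \<circ> borel_of proj1) (gen d) = incl (?p d)" for d
        by (simp add: borel_of_gen homs Pgen \<Phi>_def pairing_proj1 r)
      then have "P \<circ> borel_of proj1 \<circ> gen = incl \<circ> ?p" by (simp add: fun_eq_iff)
      then show "frame_hom (P \<circ> borel_of proj1 \<circ> gen)" by (simp add: homs)
      show "(P \<circ> borel_of proj1) (gen d) = top" if "dense d" for d
        unfolding g incl_eq_top_iff using that by (rule dense_proj1)
    qed
    then show "P (borel_of proj1 (f (gen V))) = \<Phi> (proj1 (h V))"
      by (simp add: borel_of_gen homs Pgen)
    \<comment> \<open>The point x^-1 y, which lies in every dense open by
      \<open>G.dense_times\<close>.\<close>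
    have "(P \<circ> borel_of proj2) (f (gen V)) = (P \<circ> borel_of proj2) (gen (h V))"
    proof (rule h)
      show "borel_hom (P \<circ> borel_of proj2)"
        by (intro borel_hom_comp_borel_map P borel_map_borel_of homs)
      have g: "(P \<circ> borel_of proj2) (gen d) = incl (r d)" for d
        by (simp add: borel_of_gen homs Pgen \<Phi>_def pairing_proj2 r)
      then have "P \<circ> borel_of proj2 \<circ> gen = incl \<circ> r" by (simp add: fun_eq_iff)
      then show "frame_hom (P \<circ> borel_of proj2 \<circ> gen)" by (simp add: homs r)
      show "(P \<circ> borel_of proj2) (gen d) = top" if "dense d" for d
        unfolding g incl_eq_top_iff r_def using frame_hom_incl_gen that by (rule G.dense_times)
    qed
    then show "P (borel_of proj2 (f (gen V))) = \<Phi> (proj2 (h V))"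
      by (simp add: borel_of_gen homs Pgen)
  qed
  have op: "\<exists>U. f (gen V) = gen U" for V
  proof (rule G.open_of_generic_open)
    \<comment> \<open>The preimage of \<open>V\<close> under the multiplication of H, with each
      rectangle a x b replaced by its open substitute h(a) x h(b). It expresses f(x) f(x^-1 y) in V
      at the generic pair.\<close>
    define W where "W = (SUP (a, b)\<in>rects (mH V). rect (h a) (h b))"
    have Q: "borel_hom (P \<circ> borel_prod f f)"
      by (intro borel_hom_comp_borel_map P borel_map_borel_prod f assms(3))
    have rect: "P (borel_prod f f (gen (rect a b))) = \<Phi> (rect (h a) (h b))" for a b
      using \<Phi> by (simp add: borel_prod_gen_rect f assms(3) borel_hom_simps(1)[OF P] P1 P2
          rect_eq_inf[of "h a"] frame_hom_def)
    have "incl (proj2 (incl (f (gen V)))) = P (borel_of mG (f (gen V)))" by (simp add: y)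
    \<comment> \<open>The homomorphism law enters here: f(y) = f(x) f(x^-1 y).\<close>
    also have "\<dots> = P (borel_prod f f (gen (mH V)))"
      using fm by (simp add: fun_eq_iff borel_of_gen H.mult_hom)
    also have "\<dots> = (SUP (a, b)\<in>rects (mH V). \<Phi> (rect (h a) (h b)))"
      using borel_hom_gen_tensor[OF Q \<iota> \<iota>, of "mH V"] by (simp add: rect)
    also have "\<dots> = \<Phi> W"
      using \<Phi> unfolding W_def frame_hom_def by (simp add: image_image case_prod_beta)
    finally show "incl (proj2 (incl (f (gen V)))) =
        incl (pairing ?p (G.times (?p \<circ> iG) ?q) W)"
      by (simp add: \<Phi>_def r_def)
  qed
  with frame_hom_of_open_preimages[OF f assms(3)] show ?thesis by blast
qed

end
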